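(* Let $p\in(1,\infty]$, so that the conjugate exponent satisfies $p^*\in[1,\infty)$, let $\boldsymbol{\gamma}=(\gamma_{\mathfrak{u}})_{\mathfrak{u}\subseteq\{1,2\}}$ be nonnegative weights, and let $\mathrm{QMC}_{2,n}$ be the QMC rule whose node set $\mathcal{P}=\{(x_j,y_j):j=1,\dots,n\}\subseteq[0,1)^2$ is projection regular, i.e. $\{x_j:j=1,\dots,n\}=\{y_j:j=1,\dots,n\}=\{j/n:j=0,\dots,n-1\}$. Then \[\mathrm{error}(\mathrm{QMC}_{2,n};\mathcal{F}_2)\le\frac1n\left[\frac{\gamma_{\{1\}}^{p^*}+\gamma_{\{2\}}^{p^*}}{p^*+1}+3^{p^*-1}\gamma_{\{1,2\}}^{p^*}\left(\frac{2}{(p^*+1)^2}+\big(nL_{p^*}(\mathcal{P})\big)^{p^*}\right)\right]^{1/p^*}.\] Moreover, there exists $C=C(p^* )>0$ such that for all $n$ and all such projection regular $\mathcal{P}$, \[\mathrm{error}(\mathrm{QMC}_{2,n};\mathcal{F}_2)\ge C\,\gamma_{\{1,2\}}\,L_{p^*}(\mathcal{P}).\]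
   Context: $1/p+1/p^*=1$. $\mathcal{U}_+=\{\mathfrak{u}\subseteq\{1,2\}:\gamma_{\mathfrak{u}}>0\}$. $K(x,t)=t$ if $x\ge t$, $t-1$ if $x<t$; $K_{\mathfrak{u}}(\boldsymbol{x}_{\mathfrak{u}},\boldsymbol{t}_{\mathfrak{u}})=\prod_{\ell\in\mathfrak{u}}K(x_\ell,t_\ell)$. The weighted ANOVA space $\mathcal{F}_2=\mathcal{F}_{2,p,\boldsymbol{\gamma}}=\bigoplus_{\mathfrak{u}\in\mathcal{U}_+}F_{\mathfrak{u}}$ with $F_\emptyset$ the constants (norm $|\cdot|$) and, for $\mathfrak{u}\neq\emptyset$, $F_{\mathfrak{u}}=\{\int h_{\mathfrak{u}}(\boldsymbol{t}_{\mathfrak{u}})K_{\mathfrak{u}}(\cdot_{\mathfrak{u}},\boldsymbol{t}_{\mathfrak{u}})\,\mathrm{d}\boldsymbol{t}_{\mathfrak{u}}: h_{\mathfrak{u}}\in L_p([0,1]^{|\mathfrak{u}|})\}$ with norm $\|h_{\mathfrak{u}}\|_{L_p}$; $\|f\|_{\mathcal{F}_2}=(\sum_{\mathfrak{u}\in\mathcal{U}_+}\gamma_{\mathfrak{u}}^{-p}\|f_{\mathfrak{u}}\|^p_{F_{\mathfrak{u}}})^{1/p}$ (max for $p=\infty$). QMC rule $\mathrm{QMC}_{2,n}(f)=\frac1n\sum_jf(x_j,y_j)$; worst case error $\sup_{\|f\|_{\mathcal{F}_2}\le1}|\int_{[0,1]^2}f-\mathrm{QMC}_{2,n}(f)|$.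 $L_{p^*}(\mathcal{P})=\|\Delta_{\mathcal{P}}\|_{L_{p^*}([0,1]^2)}$ with $\Delta_{\mathcal{P}}(t_1,t_2)=\frac1n\#\{j:x_j<t_1,\,y_j<t_2\}-t_1t_2$. *)

theory Defs
  imports "HOL-Analysis.Analysis" "HOL-Probability.Essential_Supremum"
begin

definition unit_int :: "real measure" where
  "unit_int = restrict_space lebesgue {0..1}"

definition unit_sq :: "(real \<times> real) measure" where
  "unit_sq = restrict_space lebesgue ({0..1} \<times> {0..1})"

definition conj_exp :: "ereal \<Rightarrow> real" where
  "conj_exp p = (if p = \<infinity> then 1 else real_of_ereal p / (real_of_ereal p - 1))"

definition memLp :: "ereal \<Rightarrow> 'a measure \<Rightarrow> ('a \<Rightarrow> real) \<Rightarrow> bool" where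
  "memLp p M h \<longleftrightarrow> h \<in> borel_measurable M \<and>
     (if p = \<infinity> then esssup M (\<lambda>z. ereal \<bar>h z\<bar>) < \<infinity>
      else integrable M (\<lambda>z. \<bar>h z\<bar> powr real_of_ereal p))"

definition Lp_norm :: "ereal \<Rightarrow> 'a measure \<Rightarrow> ('a \<Rightarrow> real) \<Rightarrow> real" where
  "Lp_norm p M h = (if p = \<infinity> then real_of_ereal (esssup M (\<lambda>z. ereal \<bar>h z\<bar>))
     else (\<integral>z. \<bar>h z\<bar> powr real_of_ereal p \<partial>M) powr (1 / real_of_ereal p))"

definition K :: "real \<Rightarrow> real \<Rightarrow> real" where
  "K x t = (if x \<ge> t then t else t - 1)"

definition anova1 :: "(real \<Rightarrow> real) \<Rightarrow> real \<Rightarrow> real" where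
  "anova1 h x = (\<integral>t. h t * K x t \<partial>unit_int)"

definition anova12 :: "(real \<times> real \<Rightarrow> real) \<Rightarrow> real \<times> real \<Rightarrow> real" where
  "anova12 h xy = (\<integral>t. h t * K (fst xy) (fst t) * K (snd xy) (snd t) \<partial>unit_sq)"

definition U_plus :: "(nat set \<Rightarrow> real) \<Rightarrow> nat set set" where
  "U_plus \<gamma> = {u. u \<subseteq> {1,2} \<and> 0 < \<gamma> u}"

definition F2_fun :: "(nat set \<Rightarrow> real) \<Rightarrow> real \<Rightarrow> (real \<Rightarrow> real) \<Rightarrow> (real \<Rightarrow> real)
    \<Rightarrow> (real \<times> real \<Rightarrow> real) \<Rightarrow> real \<times> real \<Rightarrow> real" where
  "F2_fun \<gamma> c h1 h2 h12 xy =
     (if 0 < \<gamma> {} then c else 0)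
   + (if 0 < \<gamma> {1} then anova1 h1 (fst xy) else 0)
   + (if 0 < \<gamma> {2} then anova1 h2 (snd xy) else 0)
   + (if 0 < \<gamma> {1,2} then anova12 h12 xy else 0)"

definition F2_norm :: "ereal \<Rightarrow> (nat set \<Rightarrow> real) \<Rightarrow> real \<Rightarrow> (real \<Rightarrow> real) \<Rightarrow> (real \<Rightarrow> real)
    \<Rightarrow> (real \<times> real \<Rightarrow> real) \<Rightarrow> real" where
  "F2_norm p \<gamma> c h1 h2 h12 =
    (let N = (\<lambda>u. if u = {} then \<bar>c\<bar>
                  else if u = {1} then Lp_norm p unit_int h1
                  else if u = {2} then Lp_norm p unit_int h2
                  else Lp_norm p unit_sq h12)
     in if p = \<infinity> then Max (insert 0 ((\<lambda>u. N u / \<gamma> u) ` U_plus \<gamma>))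
        else (\<Sum>u\<in>U_plus \<gamma>. \<gamma> u powr (- real_of_ereal p) * N u powr real_of_ereal p)
               powr (1 / real_of_ereal p))"

definition F2_ball :: "ereal \<Rightarrow> (nat set \<Rightarrow> real) \<Rightarrow> (real \<times> real \<Rightarrow> real) set" where
  "F2_ball p \<gamma> = {F2_fun \<gamma> c h1 h2 h12 | c h1 h2 h12.
      memLp p unit_int h1 \<and> memLp p unit_int h2 \<and> memLp p unit_sq h12 \<and>
      F2_norm p \<gamma> c h1 h2 h12 \<le> 1}"

definition QMC :: "nat \<Rightarrow> (nat \<Rightarrow> real) \<Rightarrow> (nat \<Rightarrow> real) \<Rightarrow> (real \<times> real \<Rightarrow> real) \<Rightarrow> real" where
  "QMC n x y f = (\<Sum>j=1..n. f (x j, y j)) / real n"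

text \<open>Worst case error (as an extended real, so that it is meaningful even if unbounded).\<close>
definition wce :: "ereal \<Rightarrow> (nat set \<Rightarrow> real) \<Rightarrow> nat \<Rightarrow> (nat \<Rightarrow> real) \<Rightarrow> (nat \<Rightarrow> real) \<Rightarrow> ereal" where
  "wce p \<gamma> n x y = (SUP f\<in>F2_ball p \<gamma>. ereal \<bar>(\<integral>z. f z \<partial>unit_sq) - QMC n x y f\<bar>)"

definition discrepancy :: "nat \<Rightarrow> (nat \<Rightarrow> real) \<Rightarrow> (nat \<Rightarrow> real) \<Rightarrow> real \<times> real \<Rightarrow> real" where
  "discrepancy n x y t =
     real (card {j\<in>{1..n}. x j < fst t \<and> y j < snd t}) / real n - fst t * snd t"

definition L_disc :: "real \<Rightarrow> nat \<Rightarrow> (nat \<Rightarrow> real) \<Rightarrow> (nat \<Rightarrow> real) \<Rightarrow> real" where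
  "L_disc q n x y = (\<integral>t. \<bar>discrepancy n x y t\<bar> powr q \<partial>unit_sq) powr (1 / q)"

definition proj_regular :: "nat \<Rightarrow> (nat \<Rightarrow> real) \<Rightarrow> (nat \<Rightarrow> real) \<Rightarrow> bool" where
  "proj_regular n x y \<longleftrightarrow> 0 < n \<and>
     x ` {1..n} = (\<lambda>j. real j / real n) ` {0..<n} \<and>
     y ` {1..n} = (\<lambda>j. real j / real n) ` {0..<n}"

end

theory Submission
  imports Defs "HOL-Probability.Probability_Measure"
begin

text \<open>Since \<open>K(\<cdot>, t)\<close> has mean zero, Fubini represents the integration error of a function of the ANOVA
  space by pairing its components \<open>h\<^sub>u\<close> with the univariate discrepancies \<open>\<Delta>\<^sub>1\<close>, \<open>\<Delta>\<^sub>2\<close> of the projections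
  and with \<open>G = \<Delta> - t\<^sub>1 \<Delta>\<^sub>2 - t\<^sub>2 \<Delta>\<^sub>1\<close>. By projection regularity \<open>\<parallel>\<Delta>\<^sub>i\<parallel>\<^sup>q = n\<^sup>-\<^sup>q / (q + 1)\<close> for the norm in
  \<open>L\<^sub>q\<close> with \<open>q = p\<^sup>*\<close>, so the upper bound follows from the Hoelder inequality and convexity of the
  \<open>q\<close>-th power. Conversely, Hoelder extremals give the error at least \<open>\<gamma>\<^sub>1\<^sub>2 \<parallel>G\<parallel>\<close>, and \<open>\<parallel>\<Delta>\<parallel>\<close> is at most
  \<open>\<parallel>G\<parallel>\<close> plus a multiple of \<open>1 / n\<close>. This multiple is absorbed because \<open>\<parallel>G\<parallel>\<close> itself is of order at
  least \<open>1 / n\<close>: the second difference of \<open>G\<close> over a box with sides \<open>k / n\<close> and \<open>1 / n\<close>, where \<open>k\<close> is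
  about \<open>n / 2\<close>, has distance at least \<open>1 / (3 n)\<close> from zero.\<close>

subsection \<open>Integration over the unit interval and the unit square\<close>

lemma sets_unit_cube [measurable]:
  "{0..1::real} \<in> sets lebesgue"
  "{0..1::real} \<times> {0..1::real} \<in> sets borel"
  "{0..1::real} \<times> {0..1::real} \<in> sets lebesgue"
proof -
  show "{0..1::real} \<times> {0..1::real} \<in> sets borel"
    by (intro borel_closed closed_Times closed_atLeastAtMost)
  then show "{0..1::real} \<times> {0..1::real} \<in> sets lebesgue" by auto
qed auto

lemma space_unit_int [simp]: "space unit_int = {0..1}"
  by (simp add: unit_int_def space_restrict_space)

lemma space_unit_sq [simp]: "space unit_sq = {0..1} \<times> {0..1}"
  by (simp add: unit_sq_def space_restrict_space)

lemma borel_measurable_unit_int: "f \<in> borel_measurable borel \<Longrightarrow> f \<in> borel_measurable unit_int"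
  unfolding unit_int_def by (intro measurable_restrict_space1 measurable_completion) simp

lemma borel_measurable_unit_sq: "f \<in> borel_measurable borel \<Longrightarrow> f \<in> borel_measurable unit_sq"
  unfolding unit_sq_def by (intro measurable_restrict_space1 measurable_completion) simp

lemma measurable_id_unit_int: "(\<lambda>t. t) \<in> borel_measurable unit_int"
  by (intro borel_measurable_unit_int) simp

lemma measurable_unit_coordinates [measurable]:
  "fst \<in> borel_measurable unit_sq"
  "snd \<in> borel_measurable unit_sq"
  by (intro borel_measurable_unit_sq; simp add: borel_prod[symmetric])+

lemma integral_unit_int_lborel:
  fixes f :: "real \<Rightarrow> real"
  assumes [measurable]: "f \<in> borel_measurable borel"
  shows "(\<integral>t. f t \<partial>unit_int) = (\<integral>t. indicator {0..1} t * f t \<partial>lborel)"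
  unfolding unit_int_def by (simp add: integral_restrict_space integral_completion)

lemma integral_unit_sq_lborel:
  fixes f :: "real \<times> real \<Rightarrow> real"
  assumes [measurable]: "f \<in> borel_measurable borel"
  shows "(\<integral>t. f t \<partial>unit_sq) = (\<integral>t. indicator ({0..1} \<times> {0..1}) t * f t \<partial>lborel)"
  unfolding unit_sq_def by (simp add: integral_restrict_space integral_completion)

lemma prob_space_unit_int: "prob_space unit_int"
  unfolding unit_int_def by (intro prob_space_restrict_space) auto

lemma prob_space_unit_sq: "prob_space unit_sq"
proof -
  have "emeasure (lborel \<Otimes>\<^sub>M lborel) ({0..1::real} \<times> {0..1::real}) = 1"
    by (subst lborel.emeasure_pair_measure_Times) auto
  then show ?thesis
    unfolding unit_sq_def
    by (intro prob_space_restrict_space sets_unit_cube) (simp add: lborel_prod)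
qed

lemma integrable_bounded_finite_measure:
  fixes f :: "'a \<Rightarrow> real"
  assumes "finite_measure M" "f \<in> borel_measurable M" "\<And>z. z \<in> space M \<Longrightarrow> \<bar>f z\<bar> \<le> B"
  shows "integrable M f"
  using assms by (intro finite_measure.integrable_const_bound[of M _ B]) (auto intro!: AE_I2)

text \<open>\<open>unit_sq\<close> restricts the completed measure of the plane and is not literally
  a product measure. Borel measurability of the factors allows passing to \<open>lborel\<close>,
  where Fubini applies.\<close>

lemma integral_unit_sq_product:
  fixes a b :: "real \<Rightarrow> real"
  assumes [measurable]: "a \<in> borel_measurable borel" "b \<in> borel_measurable borel"
    and int: "integrable unit_int a" "integrable unit_int b"
  shows "(\<integral>z. a (fst z) * b (snd z) \<partial>unit_sq) = (\<integral>t. a t \<partial>unit_int) * (\<integral>t. b t \<partial>unit_int)"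
proof -
  define A where "A = (\<lambda>t. indicator {0..1} t * a t)"
  define B where "B = (\<lambda>t. indicator {0..1} t * b t)"
  have [measurable]: "A \<in> borel_measurable borel" "B \<in> borel_measurable borel"
    unfolding A_def B_def by auto
  have iA: "integrable lborel A" and iB: "integrable lborel B"
    using int unfolding unit_int_def A_def B_def
    by (simp_all add: integrable_restrict_space integrable_completion)
  have "integrable (lborel \<Otimes>\<^sub>M lborel) (\<lambda>z. A (fst z) * B (snd z))"
    using iA iB by (intro lborel_pair.Fubini_integrable) (auto simp: abs_mult)
  from lborel_pair.integral_fst'[OF this]
  have "(\<integral>z. A (fst z) * B (snd z) \<partial>lborel) = (\<integral>t. A t \<partial>lborel) * (\<integral>t. B t \<partial>lborel)"
    by (simp add: lborel_prod)
  moreover have "(\<integral>z. a (fst z) * b (snd z) \<partial>unit_sq) = (\<integral>z. A (fst z) * B (snd z) \<partial>lborel)"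
    unfolding A_def B_def
    by (subst integral_unit_sq_lborel)
       (auto simp: borel_prod[symmetric] indicator_def split: if_splits intro!: Bochner_Integration.integral_cong)
  ultimately show ?thesis
    by (simp add: integral_unit_int_lborel A_def B_def)
qed

text \<open>Since the kernel is bounded by 1, \<open>h\<close> dominates the product and the order
  of integration may be exchanged; the inner integral then vanishes by \<open>k_0\<close>. All
  nonconstant ANOVA components are instances, with \<open>M\<close> carrying the argument of the
  function and \<open>N\<close> the variable of \<open>h\<close>.\<close>

lemma Fubini_kernel:
  fixes M :: "'a measure" and N :: "'b measure" and h :: "'b \<Rightarrow> real" and k :: "'a \<Rightarrow> 'b \<Rightarrow> real"
  assumes M: "prob_space M" and N: "prob_space N"
    and h: "integrable N h"
    and k: "(\<lambda>w. k (fst w) (snd w)) \<in> borel_measurable (M \<Otimes>\<^sub>M N)"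
    and k_le: "\<And>z t. z \<in> space M \<Longrightarrow> t \<in> space N \<Longrightarrow> \<bar>k z t\<bar> \<le> 1"
    and k_0: "\<And>t. t \<in> space N \<Longrightarrow> (\<integral>z. k z t \<partial>M) = 0"
  shows "integrable M (\<lambda>z. \<integral>t. h t * k z t \<partial>N)" "(\<integral>z. (\<integral>t. h t * k z t \<partial>N) \<partial>M) = 0"
proof -
  interpret M: prob_space M by (rule M)
  interpret N: prob_space N by (rule N)
  interpret pair_sigma_finite M N ..
  note h[THEN borel_measurable_integrable, measurable] k[measurable]
  have *: "integrable (M \<Otimes>\<^sub>M N) (\<lambda>w. h (snd w))"
    using h by (intro Fubini_integrable) auto
  have int: "integrable (M \<Otimes>\<^sub>M N) (\<lambda>w. h (snd w) * k (fst w) (snd w))"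
    by (rule Bochner_Integration.integrable_bound[OF *])
       (auto intro!: AE_I2 mult_left_le simp: abs_mult k_le space_pair_measure)
  from integrable_fst'[OF int] show "integrable M (\<lambda>z. \<integral>t. h t * k z t \<partial>N)" by simp
  have "(\<integral>z. (\<integral>t. h t * k z t \<partial>N) \<partial>M) = (\<integral>t. (\<integral>z. h t * k z t \<partial>M) \<partial>N)"
    using Fubini_integral[of "\<lambda>z t. h t * k z t"] int by (simp add: case_prod_beta')
  also have "\<dots> = (\<integral>t. 0 \<partial>N)"
    by (intro Bochner_Integration.integral_cong) (auto simp: k_0)
  finally show "(\<integral>z. (\<integral>t. h t * k z t \<partial>N) \<partial>M) = 0" by simp
qed

section \<open>Mean zero property of the kernel and of the ANOVA components\<close>

lemma K_eq: "K x t = t - (if x < t then 1 else 0)"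
  by (simp add: K_def)

lemma borel_measurable_K [measurable (raw)]:
  assumes [measurable]: "f \<in> borel_measurable M" "g \<in> borel_measurable M"
  shows "(\<lambda>z. K (f z) (g z)) \<in> borel_measurable M"
  unfolding K_eq by measurable

lemma abs_K_le_1: "t \<in> {0..1} \<Longrightarrow> \<bar>K x t\<bar> \<le> 1"
  by (auto simp: K_eq)

lemma integrable_K: "t \<in> {0..1} \<Longrightarrow> integrable unit_int (\<lambda>x. K x t)"
  using prob_space_unit_int
  by (intro integrable_bounded_finite_measure[of _ _ 1])
     (auto simp: prob_space.finite_measure abs_K_le_1 intro!: borel_measurable_unit_int)

text \<open>The points \<open>x < t\<close> of the unit interval have measure \<open>t\<close>,
  which cancels the mean of the constant term \<open>t\<close>.\<close>

lemma integral_K_eq_0: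
  assumes t: "t \<in> {0..1}"
  shows "(\<integral>x. K x t \<partial>unit_int) = 0"
proof -
  have "(\<integral>x. K x t \<partial>unit_int) = (\<integral>x. t * indicator {0..1} x - indicator {0..<t} x \<partial>lborel)"
    using t by (subst integral_unit_int_lborel)
      (auto simp: K_eq indicator_def intro!: Bochner_Integration.integral_cong)
  also have "\<dots> = 0"
    using t by (subst Bochner_Integration.integral_diff) auto
  finally show ?thesis .
qed

lemma anova1_integral:
  assumes h: "integrable unit_int h"
  shows "integrable unit_sq (\<lambda>z. anova1 h (fst z))" "(\<integral>z. anova1 h (fst z) \<partial>unit_sq) = 0"
    and "integrable unit_sq (\<lambda>z. anova1 h (snd z))" "(\<integral>z. anova1 h (snd z) \<partial>unit_sq) = 0"
proof -
  interpret I: prob_space unit_int by (rule prob_space_unit_int)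
  have [measurable]: "snd \<in> borel_measurable (unit_sq \<Otimes>\<^sub>M unit_int)"
    by (rule measurable_compose[OF measurable_snd measurable_id_unit_int])
  \<comment> \<open>A kernel in one coordinate is a product with constant factor 1 in the other, so
    the product formula applies.\<close>
  have K_fst: "(\<integral>z. K (fst z) t \<partial>unit_sq) = 0" if "t \<in> {0..1}" for t
    using integral_unit_sq_product[OF _ _ integrable_K[OF that] I.integrable_const[of 1]]
    by (simp add: integral_K_eq_0[OF that])
  have K_snd: "(\<integral>z. K (snd z) t \<partial>unit_sq) = 0" if "t \<in> {0..1}" for t
    using integral_unit_sq_product[OF _ _ I.integrable_const[of 1] integrable_K[OF that]]
    by (simp add: integral_K_eq_0[OF that])
  have fst: "(\<lambda>w. K (fst (fst w)) (snd w)) \<in> borel_measurable (unit_sq \<Otimes>\<^sub>M unit_int)"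
    and snd: "(\<lambda>w. K (snd (fst w)) (snd w)) \<in> borel_measurable (unit_sq \<Otimes>\<^sub>M unit_int)"
    by measurable
  note Fubini = Fubini_kernel[OF prob_space_unit_sq prob_space_unit_int h]
  show "integrable unit_sq (\<lambda>z. anova1 h (fst z))" "(\<integral>z. anova1 h (fst z) \<partial>unit_sq) = 0"
    unfolding anova1_def by (intro Fubini[of "\<lambda>z. K (fst z)", OF fst]; simp add: abs_K_le_1 K_fst)+
  show "integrable unit_sq (\<lambda>z. anova1 h (snd z))" "(\<integral>z. anova1 h (snd z) \<partial>unit_sq) = 0"
    unfolding anova1_def by (intro Fubini[of "\<lambda>z. K (snd z)", OF snd]; simp add: abs_K_le_1 K_snd)+
qed

text \<open>The kernel factors into two univariate kernels, each of mean zero.\<close>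

lemma anova12_integral:
  assumes h: "integrable unit_sq h"
  shows "integrable unit_sq (anova12 h)" "(\<integral>z. anova12 h z \<partial>unit_sq) = 0"
proof -
  have "(\<integral>z. K (fst z) (fst t) * K (snd z) (snd t) \<partial>unit_sq) = 0" if "t \<in> {0..1} \<times> {0..1}" for t
    using integral_unit_sq_product[of "\<lambda>x. K x (fst t)" "\<lambda>x. K x (snd t)"] that
    by (auto simp: integrable_K integral_K_eq_0)
  then show "integrable unit_sq (anova12 h)" "(\<integral>z. anova12 h z \<partial>unit_sq) = 0"
    unfolding anova12_def mult.assoc
    using Fubini_kernel[OF prob_space_unit_sq prob_space_unit_sq h,
        of "\<lambda>z t. K (fst z) (fst t) * K (snd z) (snd t)"]
    by (auto simp: abs_K_le_1 abs_mult mult_le_one)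
qed

subsection \<open>The error functional\<close>

definition cnt :: "nat \<Rightarrow> (nat \<Rightarrow> real) \<Rightarrow> real \<Rightarrow> nat" where
  "cnt n x t = card {j\<in>{1..n}. x j < t}"

text \<open>The local discrepancy of a one-dimensional projection of the node set.\<close>

definition disc1 :: "nat \<Rightarrow> (nat \<Rightarrow> real) \<Rightarrow> real \<Rightarrow> real" where
  "disc1 n x t = real (cnt n x t) / real n - t"

text \<open>The function \<open>G\<close> of the overview. The average of kernels is what remains
  when the QMC sum is moved inside the integral of \<open>anova12\<close>;
  \<open>anova_disc_eq\<close> recovers the form in terms of discrepancies.\<close>

definition anova_disc :: "nat \<Rightarrow> (nat \<Rightarrow> real) \<Rightarrow> (nat \<Rightarrow> real) \<Rightarrow> real \<times> real \<Rightarrow> real" where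
  "anova_disc n x y t = (\<Sum>j=1..n. K (x j) (fst t) * K (y j) (snd t)) / real n"

text \<open>As sums of indicators, counts are visibly measurable in the corner of the box and match
  the expanded kernel.\<close>

lemma card_eq_sum_indicator:
  "real (card {j\<in>{1..n}. P j}) = (\<Sum>j=1..n::nat. if P j then 1 else 0)"
  by (simp add: sum.If_cases Int_def)

lemma card_points_le: "card {j\<in>{1..n::nat}. P j} \<le> n"
  by (rule order_trans[OF card_mono[of "{1..n}"]]) auto

lemma sum_K: "n > 0 \<Longrightarrow> (\<Sum>j=1..n. K (x j) t) / real n = - disc1 n x t"
  by (simp add: disc1_def cnt_def card_eq_sum_indicator K_eq sum_subtractf field_simps
      del: One_nat_def atLeastAtMost_iff)

text \<open>Expanding the product of two kernels gives the indicator of a box, two mixed terms that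
  see only one projection each, and a constant.\<close>

lemma sum_K_K:
  "(\<Sum>j=1..n. K (x j) s * K (y j) t)
    = real (card {j\<in>{1..n}. x j < s \<and> y j < t}) - s * real (cnt n y t) - t * real (cnt n x s)
      + real n * s * t"
proof -
  have "K (x j) s * K (y j) t = (if x j < s \<and> y j < t then 1 else 0) - s * (if y j < t then 1 else 0)
      - t * (if x j < s then 1 else 0) + s * t" for j
    by (simp add: K_eq algebra_simps)
  then show ?thesis
    by (simp add: cnt_def card_eq_sum_indicator sum.distrib sum_subtractf sum_distrib_left
        del: One_nat_def atLeastAtMost_iff)
qed

text \<open>Each count divided by \<open>n\<close> is a discrepancy plus the volume it is compared
  with; the resulting multiples of \<open>fst t * snd t\<close> have coefficients 1, -1, -1, 1 and
  cancel.\<close>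

lemma anova_disc_eq:
  assumes "n > 0"
  shows "anova_disc n x y t
    = discrepancy n x y t - fst t * disc1 n y (snd t) - snd t * disc1 n x (fst t)"
  unfolding anova_disc_def sum_K_K using assms
  by (simp add: discrepancy_def disc1_def field_simps del: One_nat_def atLeastAtMost_iff)

lemma borel_measurable_disc1 [measurable]: "disc1 n x \<in> borel_measurable borel"
  unfolding disc1_def[abs_def] cnt_def card_eq_sum_indicator by measurable

lemma borel_measurable_anova_disc [measurable]: "anova_disc n x y \<in> borel_measurable borel"
  unfolding anova_disc_def[abs_def] borel_prod[symmetric] by measurable

lemma borel_measurable_discrepancy [measurable]: "discrepancy n x y \<in> borel_measurable borel"
  unfolding discrepancy_def[abs_def] card_eq_sum_indicator borel_prod[symmetric] by measurable

lemma cnt_le: "cnt n x t \<le> n"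
  unfolding cnt_def by (rule card_points_le)

text \<open>A difference of two numbers from the unit interval. This and the two bounds below are
  crude; they serve to make products and powers integrable.\<close>

lemma abs_disc1_le_1:
  assumes "n > 0" "t \<in> {0..1}"
  shows "\<bar>disc1 n x t\<bar> \<le> 1"
proof -
  have "real (cnt n x t) / real n \<in> {0..1}"
    using assms cnt_le[of n x t] by simp
  then show ?thesis
    using assms(2) unfolding disc1_def atLeastAtMost_iff abs_le_iff by linarith
qed

lemma abs_anova_disc_le_1:
  assumes "n > 0" "t \<in> {0..1} \<times> {0..1}"
  shows "\<bar>anova_disc n x y t\<bar> \<le> 1"
proof -
  have "\<bar>\<Sum>j=1..n. K (x j) (fst t) * K (y j) (snd t)\<bar> \<le> (\<Sum>j=1..n. 1)"
    using assms by (intro order_trans[OF sum_abs] sum_mono) (auto simp: abs_mult intro!: mult_le_one abs_K_le_1)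
  then show ?thesis using assms by (simp add: anova_disc_def)
qed

lemma abs_discrepancy_le_1:
  assumes "n > 0" "t \<in> {0..1} \<times> {0..1}"
  shows "\<bar>discrepancy n x y t\<bar> \<le> 1"
proof -
  have "card {j\<in>{1..n}. x j < fst t \<and> y j < snd t} \<le> n"
    by (rule card_points_le)
  then have "real (card {j\<in>{1..n}. x j < fst t \<and> y j < snd t}) / real n \<in> {0..1}"
    using assms by auto
  moreover have "fst t * snd t \<in> {0..1}" using assms by (auto intro: mult_le_one)
  ultimately show ?thesis unfolding discrepancy_def atLeastAtMost_iff abs_le_iff by linarith
qed

lemma integrable_mult_bounded:
  fixes h g :: "'a \<Rightarrow> real"
  assumes "integrable M h" "g \<in> borel_measurable M" "\<And>t. t \<in> space M \<Longrightarrow> \<bar>g t\<bar> \<le> 1"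
  shows "integrable M (\<lambda>t. h t * g t)"
  using assms borel_measurable_integrable[OF assms(1)]
  by (intro Bochner_Integration.integrable_bound[OF assms(1)])
     (auto intro!: mult_left_le simp: abs_mult)

lemma QMC_anova1:
  assumes n: "n > 0" and h: "integrable unit_int h"
  shows "(\<Sum>j=1..n. anova1 h (x j)) / real n = - (\<integral>t. h t * disc1 n x t \<partial>unit_int)"
proof -
  have "(\<Sum>j=1..n. anova1 h (x j)) = (\<integral>t. (\<Sum>j=1..n. h t * K (x j) t) \<partial>unit_int)"
    unfolding anova1_def
    by (intro Bochner_Integration.integral_sum[symmetric] integrable_mult_bounded h)
       (auto intro!: borel_measurable_unit_int abs_K_le_1)
  also have "\<dots> = (\<integral>t. - real n * (h t * disc1 n x t) \<partial>unit_int)"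
    using sum_K[OF n, of x] n
    by (intro Bochner_Integration.integral_cong)
       (auto simp: sum_distrib_left[symmetric] field_simps)
  finally show ?thesis using n by simp
qed

lemma QMC_anova12:
  assumes n: "n > 0" and h: "integrable unit_sq h"
  shows "(\<Sum>j=1..n. anova12 h (x j, y j)) / real n = (\<integral>t. h t * anova_disc n x y t \<partial>unit_sq)"
proof -
  have "(\<Sum>j=1..n. anova12 h (x j, y j))
      = (\<integral>t. (\<Sum>j=1..n. h t * (K (x j) (fst t) * K (y j) (snd t))) \<partial>unit_sq)"
    unfolding anova12_def mult.assoc fst_conv snd_conv
    by (intro Bochner_Integration.integral_sum[symmetric] integrable_mult_bounded h)
       (auto simp: abs_mult intro!: mult_le_one abs_K_le_1)
  also have "\<dots> = (\<integral>t. real n * (h t * anova_disc n x y t) \<partial>unit_sq)"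
    using n unfolding anova_disc_def
    by (intro Bochner_Integration.integral_cong)
       (auto simp: sum_distrib_left[symmetric] field_simps)
  finally show ?thesis using n by simp
qed

text \<open>The constant is integrated exactly by both sides and the other components have integral
  zero, so the error is minus their QMC averages. The univariate terms change sign once more because
  averaging \<open>K\<close> gives minus the discrepancy.\<close>

lemma QMC_error_F2_fun:
  assumes n: "n > 0"
    and h: "integrable unit_int h1" "integrable unit_int h2" "integrable unit_sq h12"
  shows "(\<integral>z. F2_fun \<gamma> c h1 h2 h12 z \<partial>unit_sq) - QMC n x y (F2_fun \<gamma> c h1 h2 h12)
    = (if 0 < \<gamma> {1} then \<integral>t. h1 t * disc1 n x t \<partial>unit_int else 0)
    + (if 0 < \<gamma> {2} then \<integral>t. h2 t * disc1 n y t \<partial>unit_int else 0)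
    - (if 0 < \<gamma> {1,2} then \<integral>t. h12 t * anova_disc n x y t \<partial>unit_sq else 0)"
proof -
  interpret S: prob_space unit_sq by (rule prob_space_unit_sq)
  note [simp] = anova1_integral[OF h(1)] anova1_integral[OF h(2)] anova12_integral[OF h(3)]
  have "(\<integral>z. F2_fun \<gamma> c h1 h2 h12 z \<partial>unit_sq) = (if 0 < \<gamma> {} then c else 0)"
    unfolding F2_fun_def
    by (cases "0 < \<gamma> {1}"; cases "0 < \<gamma> {2}"; cases "0 < \<gamma> {1,2}") (simp_all add: S.prob_space[simplified])
  moreover have "QMC n x y (F2_fun \<gamma> c h1 h2 h12) = (if 0 < \<gamma> {} then c else 0)
    - (if 0 < \<gamma> {1} then \<integral>t. h1 t * disc1 n x t \<partial>unit_int else 0)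
    - (if 0 < \<gamma> {2} then \<integral>t. h2 t * disc1 n y t \<partial>unit_int else 0)
    + (if 0 < \<gamma> {1,2} then \<integral>t. h12 t * anova_disc n x y t \<partial>unit_sq else 0)"
    using n QMC_anova1[OF n h(1), of x] QMC_anova1[OF n h(2), of y] QMC_anova12[OF n h(3), of x y]
    unfolding QMC_def F2_fun_def
    by (simp add: sum.distrib add_divide_distrib)
  ultimately show ?thesis by simp
qed

subsection \<open>Discrepancy of projection regular point sets\<close>

text \<open>This is convexity of the \<open>q\<close>-th power, obtained from Young's inequality:
  pairing each of the three numbers with \<open>m powr (q - 1)\<close>, where \<open>m\<close> is
  their mean, amounts to the tangent bound at \<open>m\<close>.\<close>

lemma powr_sum3_le:
  fixes a b c q :: real
  assumes q: "q \<ge> 1" and pos: "a \<ge> 0" "b \<ge> 0" "c \<ge> 0"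
  shows "(a + b + c) powr q \<le> 3 powr (q - 1) * (a powr q + b powr q + c powr q)"
proof (cases "q = 1 \<or> a + b + c = 0")
  case True
  then show ?thesis using assms by auto
next
  case False
  define m where "m = (a + b + c) / 3"
  have q1: "q > 1" and m: "m > 0" using False assms by (auto simp: m_def)
  have mq: "(m powr (q - 1)) powr (q / (q - 1)) = m powr q"
    using q1 by (simp add: powr_powr)
  have Y: "u * m powr (q - 1) \<le> u powr q / q + m powr q * (1 - 1 / q)" if "u \<ge> 0" for u
  proof -
    have "u * m powr (q - 1) \<le> u powr q / q + (m powr (q - 1)) powr (q / (q - 1)) / (q / (q - 1))"
      using q1 that by (intro Youngs_inequality) (auto simp: field_simps)
    then show ?thesis using q1 unfolding mq by (simp add: field_simps)
  qed
  \<comment> \<open>Summing the three Young bounds reproduces the fraction \<open>1 - 1 / q\<close>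
    of the left side, so only the fraction \<open>1 / q\<close> of it survives.\<close>
  have "3 * m powr q = (a + b + c) * m powr (q - 1)"
    using m by (simp add: m_def powr_diff)
  also have "\<dots> \<le> (a powr q + b powr q + c powr q) / q + 3 * (m powr q * (1 - 1 / q))"
    using Y[of a] Y[of b] Y[of c] pos by (simp add: add_divide_distrib ring_distribs)
  finally have "3 * m powr q / q \<le> (a powr q + b powr q + c powr q) / q"
    by (simp add: right_diff_distrib)
  then have *: "3 * m powr q \<le> a powr q + b powr q + c powr q"
    using q1 by (simp add: divide_le_cancel)
  have "(a + b + c) powr q = (3 * m) powr q" unfolding m_def by (rule arg_cong2[of _ _ _ _ "(powr)"]) auto
  also have "\<dots> = 3 powr (q - 1) * (3 * m powr q)"
    using m by (simp add: powr_mult powr_diff)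
  finally show ?thesis using * by simp
qed

section \<open>The univariate discrepancy of a regular projection\<close>

lemma cnt_regular:
  assumes n: "n > 0" and x: "x ` {1..n} = (\<lambda>j. real j / real n) ` {0..<n}"
    and t: "t \<in> {0..1}"
  shows "int (cnt n x t) = \<lceil>real n * t\<rceil>"
proof -
  have inj: "inj_on (\<lambda>j. real j / real n) {0..<n}" using n by (auto simp: inj_on_def)
  \<comment> \<open>The \<open>n\<close> indices hit \<open>n\<close> different grid values, so no
    value repeats and counting indices is the same as counting grid points.\<close>
  have "card (x ` {1..n}) = card {1..n}"
    unfolding x card_image[OF inj] by simp
  then have injx: "inj_on x {1..n}" by (simp add: eq_card_imp_inj_on)
  have "cnt n x t = card (x ` {j\<in>{1..n}. x j < t})"
    unfolding cnt_def by (rule card_image[symmetric]) (rule inj_on_subset[OF injx], auto)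
  also have "x ` {j\<in>{1..n}. x j < t} = {v\<in>x ` {1..n}. v < t}" by auto
  also have "\<dots> = (\<lambda>j. real j / real n) ` {j\<in>{0..<n}. real j / real n < t}"
    unfolding x by auto
  also have "card \<dots> = card {j\<in>{0..<n}. real j / real n < t}"
    by (rule card_image) (rule inj_on_subset[OF inj], auto)
  \<comment> \<open>The strict inequality \<open>j < n * t\<close> is equivalent to \<open>j\<close>
    being below the ceiling; since \<open>t \<le> 1\<close>, the ceiling does not exceed
    \<open>n\<close> and the count is not truncated.\<close>
  also have "{j\<in>{0..<n}. real j / real n < t} = {0..<nat \<lceil>real n * t\<rceil>}"
  proof -
    define c where "c = \<lceil>real n * t\<rceil>"
    have c_le: "c \<le> int n" using t n by (simp add: c_def ceiling_le_iff mult_left_le)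
    have less_c: "real j / real n < t \<longleftrightarrow> int j < c" for j
      using n by (simp add: c_def less_ceiling_iff divide_less_eq mult.commute)
    have "{j\<in>{0..<n}. real j / real n < t} = {j\<in>{0..<n}. int j < c}" by (simp only: less_c)
    also have "\<dots> = {0..<nat c}" using c_le by auto
    finally have "{j\<in>{0..<n}. real j / real n < t} = {0..<nat c}" .
    then show ?thesis by (simp only: c_def)
  qed
  finally have "cnt n x t = nat \<lceil>real n * t\<rceil>" by simp
  moreover have "0 \<le> real n * t" using t by simp
  then have "0 \<le> \<lceil>real n * t\<rceil>" by linarith
  ultimately show ?thesis by simp
qed

text \<open>The discrepancy is a sawtooth: inside a grid cell the count is constantly
  \<open>Suc m\<close>, so \<open>disc1\<close> is the distance to the right end of the
  cell.\<close>

lemma has_integral_disc1_powr_cell: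
  assumes n: "n > 0" and x: "x ` {1..n} = (\<lambda>j. real j / real n) ` {0..<n}"
    and m: "m < n" and q: "q \<ge> 1"
  shows "((\<lambda>t. \<bar>disc1 n x t\<bar> powr q) has_integral (1 / real n) powr (q + 1) / (q + 1))
    {real m / real n .. real (Suc m) / real n}"
proof -
  define b where "b = real (Suc m) / real n"
  have ab: "real m / real n \<le> b" using n by (simp add: b_def field_simps)
  have "((\<lambda>t. (b - t) powr q) has_integral
      (- ((b - b) powr (q + 1) / (q + 1)) - - ((b - real m / real n) powr (q + 1) / (q + 1))))
      {real m / real n .. b}"
  \<comment> \<open>The interior version is used because the derivative of the power is computed for
    a positive base, which fails at \<open>t = b\<close>.\<close>
  proof (rule fundamental_theorem_of_calculus_interior[OF ab])
    show "continuous_on {real m / real n..b} (\<lambda>t. - ((b - t) powr (q + 1) / (q + 1)))"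
      using q by (intro continuous_intros continuous_on_powr') auto
    fix t assume "t \<in> {real m / real n<..<b}"
    then have "((\<lambda>t. (b - t) powr (q + 1)) has_real_derivative - ((q + 1) * (b - t) powr q)) (at t)"
      by (auto intro!: derivative_eq_intros)
    from DERIV_minus[OF DERIV_cdivide[OF this, of "q + 1"]]
    show "((\<lambda>t. - ((b - t) powr (q + 1) / (q + 1))) has_vector_derivative (b - t) powr q) (at t)"
      using q unfolding has_real_derivative_iff_has_vector_derivative[symmetric] by simp
  qed
  moreover have "b - real m / real n = 1 / real n" using n by (simp add: b_def field_simps)
  ultimately have I: "((\<lambda>t. (b - t) powr q) has_integral (1 / real n) powr (q + 1) / (q + 1))
      {real m / real n .. b}" by simp
  \<comment> \<open>At the left endpoint the count is still \<open>m\<close> and the discrepancy is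
    0 instead of \<open>1 / n\<close>; this single point is removed as a null set.\<close>
  have "\<bar>disc1 n x t\<bar> powr q = (b - t) powr q" if t: "t \<in> {real m / real n .. b} - {real m / real n}" for t
  proof -
    have "b \<le> 1" using m n by (simp add: b_def)
    moreover have "0 \<le> t" using t by (intro order_trans[of 0 "real m / real n" t]) auto
    ultimately have t01: "t \<in> {0..1}" using t by auto
    have "real m < real n * t" "real n * t \<le> real m + 1"
      using t n by (auto simp: b_def field_simps)
    then have "\<lceil>real n * t\<rceil> = int m + 1" by linarith
    then have "cnt n x t = Suc m" using cnt_regular[OF n x t01] by simp
    then have "disc1 n x t = b - t" by (simp add: disc1_def b_def)
    then show ?thesis using t by auto
  qed
  then show ?thesis unfolding b_def[symmetric]
    by (intro has_integral_spike_finite[OF _ _ I, of "{real m / real n}"]) auto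
qed

lemma integral_disc1_powr:
  assumes n: "n > 0" and x: "x ` {1..n} = (\<lambda>j. real j / real n) ` {0..<n}" and q: "q \<ge> 1"
  shows "(\<integral>t. \<bar>disc1 n x t\<bar> powr q \<partial>unit_int) = (1 / real n) powr q / (q + 1)"
proof -
  let ?f = "\<lambda>t. \<bar>disc1 n x t\<bar> powr q"
  \<comment> \<open>The cells are glued one by one; all \<open>n\<close> of them contribute
    equally.\<close>
  have "m \<le> n \<Longrightarrow> (?f has_integral real m * ((1 / real n) powr (q + 1) / (q + 1))) {0 .. real m / real n}" for m
  proof (induction m)
    case 0
    then show ?case using has_integral_refl(2)[of ?f 0] by simp
  next
    case (Suc m)
    have "(?f has_integral (real m * ((1 / real n) powr (q + 1) / (q + 1)) + (1 / real n) powr (q + 1) / (q + 1)))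
        {0 .. real (Suc m) / real n}"
      by (rule has_integral_combine[of _ "real m / real n"])
         (use Suc n has_integral_disc1_powr_cell[OF n x, of m q] q in \<open>auto simp: divide_right_mono\<close>)
    then show ?case by (simp add: algebra_simps add_divide_distrib)
  qed
  from this[of n] n have *: "integral {0..1} ?f = (1 / real n) powr q / (q + 1)"
    by (auto simp: powr_add intro!: integral_unique)
  interpret I: prob_space unit_int by (rule prob_space_unit_int)
  have "integrable unit_int ?f"
    using n q I.finite_measure_axioms
    by (intro integrable_bounded_finite_measure[of _ _ 1] borel_measurable_unit_int)
       (auto intro!: powr_le1 abs_disc1_le_1)
  then have "set_integrable lborel {0..1} ?f"
    unfolding unit_int_def set_integrable_def
    by (simp add: integrable_restrict_space integrable_completion)
  from set_borel_integral_eq_integral(2)[OF this] * show ?thesis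
    by (simp add: integral_unit_int_lborel set_lebesgue_integral_def)
qed

lemma integral_powr_unit_int:
  assumes q: "q \<ge> 1"
  shows "(\<integral>t. t powr q \<partial>unit_int) = 1 / (q + 1)"
proof -
  have "((\<lambda>t. t powr q) has_integral (1 powr (q + 1) / (q + 1) - 0 powr (q + 1) / (q + 1))) {0..1::real}"
  proof (rule fundamental_theorem_of_calculus_interior)
    show "continuous_on {0..1} (\<lambda>t::real. t powr (q + 1) / (q + 1))"
      using q by (intro continuous_intros continuous_on_powr') auto
    fix t :: real assume "t \<in> {0<..<1}"
    then have "((\<lambda>t. t powr (q + 1)) has_real_derivative (q + 1) * t powr q) (at t)"
      by (auto intro!: derivative_eq_intros)
    from DERIV_cdivide[OF this, of "q + 1"]
    show "((\<lambda>t. t powr (q + 1) / (q + 1)) has_vector_derivative t powr q) (at t)"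
      using q unfolding has_real_derivative_iff_has_vector_derivative[symmetric] by simp
  qed simp
  then have *: "integral {0..1::real} (\<lambda>t. t powr q) = 1 / (q + 1)"
    by (auto intro!: integral_unique)
  interpret I: prob_space unit_int by (rule prob_space_unit_int)
  have "integrable unit_int (\<lambda>t. t powr q)"
    using q I.finite_measure_axioms
    by (intro integrable_bounded_finite_measure[of _ _ 1] borel_measurable_unit_int)
       (auto intro!: powr_le1)
  then have "set_integrable lborel {0..1} (\<lambda>t. t powr q)"
    unfolding unit_int_def set_integrable_def
    by (simp add: integrable_restrict_space integrable_completion)
  from set_borel_integral_eq_integral(2)[OF this] * show ?thesis
    by (simp add: integral_unit_int_lborel set_lebesgue_integral_def)
qed

text \<open>These are the two terms by which \<open>anova_disc\<close> and the discrepancy differ.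
  Each integrand factors, and each factor contributes one \<open>1 / (q + 1)\<close>.\<close>

lemma integral_powr_product:
  assumes n: "n > 0" and x: "x ` {1..n} = (\<lambda>j. real j / real n) ` {0..<n}" and q: "q \<ge> 1"
  shows "(\<integral>z. \<bar>fst z * disc1 n x (snd z)\<bar> powr q \<partial>unit_sq) = (1 / real n) powr q / (q + 1)^2"
    "(\<integral>z. \<bar>snd z * disc1 n x (fst z)\<bar> powr q \<partial>unit_sq) = (1 / real n) powr q / (q + 1)^2"
proof -
  interpret I: prob_space unit_int by (rule prob_space_unit_int)
  have i1: "integrable unit_int (\<lambda>t. \<bar>t\<bar> powr q)"
    and i2: "integrable unit_int (\<lambda>t. \<bar>disc1 n x t\<bar> powr q)"
    using n q I.finite_measure_axioms
    by (intro integrable_bounded_finite_measure[of _ _ 1] borel_measurable_unit_int;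
        auto intro!: powr_le1 abs_disc1_le_1)+
  have I1: "(\<integral>t. \<bar>t\<bar> powr q \<partial>unit_int) = 1 / (q + 1)"
    unfolding integral_powr_unit_int[OF q, symmetric]
    by (intro Bochner_Integration.integral_cong) auto
  show "(\<integral>z. \<bar>fst z * disc1 n x (snd z)\<bar> powr q \<partial>unit_sq) = (1 / real n) powr q / (q + 1)^2"
    using integral_unit_sq_product[OF _ _ i1 i2]
    by (simp add: abs_mult powr_mult I1 integral_disc1_powr[OF n x q] power2_eq_square)
  show "(\<integral>z. \<bar>snd z * disc1 n x (fst z)\<bar> powr q \<partial>unit_sq) = (1 / real n) powr q / (q + 1)^2"
    using integral_unit_sq_product[OF _ _ i2 i1]
    by (simp add: abs_mult powr_mult I1 integral_disc1_powr[OF n x q] power2_eq_square mult.commute)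
qed

lemma integral_powr_sum3_le:
  fixes f g h k :: "real \<times> real \<Rightarrow> real"
  assumes q: "q \<ge> 1"
    and [measurable]: "f \<in> borel_measurable borel" "g \<in> borel_measurable borel"
      "h \<in> borel_measurable borel" "k \<in> borel_measurable borel"
    and le: "\<And>t. t \<in> {0..1} \<times> {0..1} \<Longrightarrow> \<bar>f t\<bar> \<le> \<bar>g t\<bar> + \<bar>h t\<bar> + \<bar>k t\<bar>"
    and bd: "\<And>t. t \<in> {0..1} \<times> {0..1} \<Longrightarrow> \<bar>f t\<bar> \<le> 1" "\<And>t. t \<in> {0..1} \<times> {0..1} \<Longrightarrow> \<bar>g t\<bar> \<le> 1"
       "\<And>t. t \<in> {0..1} \<times> {0..1} \<Longrightarrow> \<bar>h t\<bar> \<le> 1" "\<And>t. t \<in> {0..1} \<times> {0..1} \<Longrightarrow> \<bar>k t\<bar> \<le> 1"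
  shows "(\<integral>t. \<bar>f t\<bar> powr q \<partial>unit_sq) \<le> 3 powr (q - 1) * ((\<integral>t. \<bar>g t\<bar> powr q \<partial>unit_sq)
     + (\<integral>t. \<bar>h t\<bar> powr q \<partial>unit_sq) + (\<integral>t. \<bar>k t\<bar> powr q \<partial>unit_sq))"
proof -
  interpret S: prob_space unit_sq by (rule prob_space_unit_sq)
  have int: "integrable unit_sq (\<lambda>t. \<bar>u t\<bar> powr q)"
    if "u \<in> borel_measurable borel" "\<And>t. t \<in> {0..1} \<times> {0..1} \<Longrightarrow> \<bar>u t\<bar> \<le> 1" for u
    using that q S.finite_measure_axioms
    by (intro integrable_bounded_finite_measure[of _ _ 1] borel_measurable_unit_sq) (auto intro!: powr_le1)
  have "(\<integral>t. \<bar>f t\<bar> powr q \<partial>unit_sq)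
      \<le> (\<integral>t. 3 powr (q - 1) * (\<bar>g t\<bar> powr q + \<bar>h t\<bar> powr q + \<bar>k t\<bar> powr q) \<partial>unit_sq)"
  proof (intro integral_mono)
    fix t assume "t \<in> space unit_sq"
    then have "\<bar>f t\<bar> powr q \<le> (\<bar>g t\<bar> + \<bar>h t\<bar> + \<bar>k t\<bar>) powr q"
      using q by (intro powr_mono2 le) auto
    then show "\<bar>f t\<bar> powr q \<le> 3 powr (q - 1) * (\<bar>g t\<bar> powr q + \<bar>h t\<bar> powr q + \<bar>k t\<bar> powr q)"
      using powr_sum3_le[OF q, of "\<bar>g t\<bar>" "\<bar>h t\<bar>" "\<bar>k t\<bar>"] by simp
  qed (auto intro!: int bd Bochner_Integration.integrable_add)
  also have "\<dots> = 3 powr (q - 1) * ((\<integral>t. \<bar>g t\<bar> powr q \<partial>unit_sq)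
     + (\<integral>t. \<bar>h t\<bar> powr q \<partial>unit_sq) + (\<integral>t. \<bar>k t\<bar> powr q \<partial>unit_sq))"
    by (simp add: int bd)
  finally show ?thesis .
qed

text \<open>Either function is the other one plus or minus the same two correction terms, whose
  norms are known. The first inequality serves the upper bound, the second the lower bound.\<close>

lemma anova_disc_discrepancy_comparison:
  assumes reg: "proj_regular n x y" and q: "q \<ge> 1"
  shows "(\<integral>t. \<bar>anova_disc n x y t\<bar> powr q \<partial>unit_sq) \<le> 3 powr (q - 1) *
      ((\<integral>t. \<bar>discrepancy n x y t\<bar> powr q \<partial>unit_sq) + 2 * (1 / real n) powr q / (q + 1)^2)"
    and "(\<integral>t. \<bar>discrepancy n x y t\<bar> powr q \<partial>unit_sq) \<le> 3 powr (q - 1) *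
      ((\<integral>t. \<bar>anova_disc n x y t\<bar> powr q \<partial>unit_sq) + 2 * (1 / real n) powr q / (q + 1)^2)"
proof -
  have n: "n > 0" and x: "x ` {1..n} = (\<lambda>j. real j / real n) ` {0..<n}"
    and y: "y ` {1..n} = (\<lambda>j. real j / real n) ` {0..<n}"
    using reg by (auto simp: proj_regular_def)
  have [measurable]: "(\<lambda>z. fst z * disc1 n y (snd z)) \<in> borel_measurable borel"
    "(\<lambda>z. snd z * disc1 n x (fst z)) \<in> borel_measurable borel"
    unfolding borel_prod[symmetric] by measurable
  have bd: "\<bar>fst z * disc1 n y (snd z)\<bar> \<le> 1" "\<bar>snd z * disc1 n x (fst z)\<bar> \<le> 1"
    if "z \<in> {0..1} \<times> {0..1}" for z
    using that n by (auto simp: abs_mult intro!: mult_le_one abs_disc1_le_1)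
  have eq: "(\<integral>z. \<bar>fst z * disc1 n y (snd z)\<bar> powr q \<partial>unit_sq)
      + (\<integral>z. \<bar>snd z * disc1 n x (fst z)\<bar> powr q \<partial>unit_sq) = 2 * (1 / real n) powr q / (q + 1)^2"
    by (simp add: integral_powr_product(1)[OF n y q] integral_powr_product(2)[OF n x q])
  have le1: "\<bar>anova_disc n x y t\<bar>
      \<le> \<bar>discrepancy n x y t\<bar> + \<bar>fst t * disc1 n y (snd t)\<bar> + \<bar>snd t * disc1 n x (fst t)\<bar>"
    and le2: "\<bar>discrepancy n x y t\<bar>
      \<le> \<bar>anova_disc n x y t\<bar> + \<bar>fst t * disc1 n y (snd t)\<bar> + \<bar>snd t * disc1 n x (fst t)\<bar>" for t
    using anova_disc_eq[OF n, of x y t] by linarith+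
  show "(\<integral>t. \<bar>anova_disc n x y t\<bar> powr q \<partial>unit_sq) \<le> 3 powr (q - 1) *
      ((\<integral>t. \<bar>discrepancy n x y t\<bar> powr q \<partial>unit_sq) + 2 * (1 / real n) powr q / (q + 1)^2)"
    unfolding eq[symmetric] add.assoc[symmetric]
    by (rule integral_powr_sum3_le[OF q])
       (measurable, auto intro: le1 bd simp: abs_anova_disc_le_1[OF n] abs_discrepancy_le_1[OF n])
  show "(\<integral>t. \<bar>discrepancy n x y t\<bar> powr q \<partial>unit_sq) \<le> 3 powr (q - 1) *
      ((\<integral>t. \<bar>anova_disc n x y t\<bar> powr q \<partial>unit_sq) + 2 * (1 / real n) powr q / (q + 1)^2)"
    unfolding eq[symmetric] add.assoc[symmetric]
    by (rule integral_powr_sum3_le[OF q])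
       (measurable, auto intro: le2 bd simp: abs_anova_disc_le_1[OF n] abs_discrepancy_le_1[OF n])
qed

section \<open>Lower bound of order \<open>1 / n\<close> for the norm of
  \<open>anova_disc\<close>\<close>

lemma cnt_regular_shift:
  assumes "n > 0" "x ` {1..n} = (\<lambda>j. real j / real n) ` {0..<n}"
    and "0 \<le> s" "s + real k / real n \<le> 1"
  shows "cnt n x (s + real k / real n) = cnt n x s + k"
proof -
  have "0 \<le> real k / real n" by simp
  then have "s \<in> {0..1}" "s + real k / real n \<in> {0..1}"
    unfolding atLeastAtMost_iff using assms(3,4) by linarith+
  moreover have "real n * (s + real k / real n) = real n * s + of_int (int k)"
    using assms(1) by (simp add: distrib_left)
  then have "\<lceil>real n * (s + real k / real n)\<rceil> = \<lceil>real n * s\<rceil> + int k"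
    by (simp only: ceiling_add_of_int)
  ultimately have "int (cnt n x (s + real k / real n)) = int (cnt n x s) + int k"
    using cnt_regular[OF assms(1,2)] by simp
  then show ?thesis by linarith
qed

text \<open>The univariate terms of the ANOVA kernel cancel in second differences along the grid, leaving
  the discrepancy of a box of area \<open>k / n\<^sup>2\<close>, which is no integer multiple of \<open>1 / n\<close>.\<close>

lemma anova_disc_second_difference:
  fixes s t :: real
  assumes reg: "proj_regular n x y" and n2: "n \<ge> 2" and k: "k = n div 2"
    and s: "0 \<le> s" "s \<le> 1/2" and t: "0 \<le> t" "t \<le> 1/2"
  shows "1 / (3 * real n) \<le> \<bar>anova_disc n x y (s + real k / real n, t + 1 / real n)
    - anova_disc n x y (s + real k / real n, t) - anova_disc n x y (s, t + 1 / real n)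
    + anova_disc n x y (s, t)\<bar>"
proof -
  have n: "n > 0" and x: "x ` {1..n} = (\<lambda>j. real j / real n) ` {0..<n}"
    and y: "y ` {1..n} = (\<lambda>j. real j / real n) ` {0..<n}"
    using reg by (auto simp: proj_regular_def)
  define a where "a = real k / real n"
  define b where "b = 1 / real n"
  define c where "c = (\<lambda>u v. int (card {j\<in>{1..n}. x j < u \<and> y j < v}))"
  have a_le: "a \<le> 1/2" using k n by (simp add: a_def field_simps)
  have b_le: "b \<le> 1/2" using n2 by (simp add: b_def field_simps)
  have cx: "real (cnt n x (s + a)) = real (cnt n x s) + real k"
    using cnt_regular_shift[OF n x s(1), of k, folded a_def] a_le s by simp
  have cy: "real (cnt n y (t + b)) = real (cnt n y t) + 1"
    using cnt_regular_shift[OF n y t(1), of 1, unfolded of_nat_1, folded b_def] b_le t by simp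
  have G: "real n * anova_disc n x y (u, v)
      = c u v - u * real (cnt n y v) - v * real (cnt n x u) + real n * u * v" for u v
    using n by (simp only: anova_disc_def sum_K_K c_def) simp
  define d where "d = anova_disc n x y (s + a, t + b) - anova_disc n x y (s + a, t)
     - anova_disc n x y (s, t + b) + anova_disc n x y (s, t)"
  define z where "z = c (s + a) (t + b) - c (s + a) t - c s (t + b) + c s t"
  \<comment> \<open>Here \<open>z\<close> is the number of nodes in the box. By \<open>cx\<close>
    and \<open>cy\<close> the projection counts grow by exactly \<open>k\<close> and 1, whatever
    \<open>s\<close> and \<open>t\<close> are, so the rest is explicit and amounts to
    \<open>z - k / n\<close>.\<close>
  have "real n * d = z - a - b * real k + real n * a * b"
    unfolding d_def ring_distribs G cx cy z_def by (simp add: algebra_simps)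
  then have "real n * (real n * d) = real n * (z - a - b * real k + real n * a * b)"
    by (rule arg_cong)
  also have "\<dots> = real_of_int (int n * z - int k)"
    using n by (simp add: a_def b_def field_simps)
  finally have D: "real n * (real n * d) = real_of_int (int n * z - int k)" .
  \<comment> \<open>The multiples \<open>n * z\<close> of \<open>n\<close> stay at distance at least
    \<open>k\<close> from \<open>k\<close>: for \<open>z \<le> 0\<close> directly, and for
    \<open>z \<ge> 1\<close> because \<open>n - k \<ge> k\<close>.\<close>
  have "int k \<le> \<bar>int n * z - int k\<bar>"
  proof (cases "z \<le> 0")
    case True
    then have "int n * z \<le> 0" by (simp add: mult_nonneg_nonpos)
    then show ?thesis by linarith
  next
    case False
    then have "int n * 1 \<le> int n * z" by (intro mult_left_mono) auto
    moreover have "2 * int k \<le> int n" using k by linarith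
    ultimately show ?thesis by linarith
  qed
  then have "real k \<le> \<bar>real n * (real n * d)\<bar>" unfolding D by linarith
  \<comment> \<open>The extreme case is \<open>n = 3\<close>, \<open>k = 1\<close>; this is the
    source of the constant 3 in the bound.\<close>
  moreover have "n \<le> 3 * k" using k n2 by linarith
  then have "real n \<le> 3 * real k" by linarith
  ultimately have "real n * 1 \<le> real n * (3 * real n * \<bar>d\<bar>)" by (simp add: abs_mult)
  then have "1 \<le> 3 * real n * \<bar>d\<bar>" using n by (simp only: mult_le_cancel_left_pos of_nat_0_less_iff)
  then have "1 / (3 * real n) \<le> \<bar>d\<bar>" using n by (simp add: divide_le_eq mult.commute)
  then show ?thesis by (simp only: d_def a_def b_def)
qed

text \<open>By translation invariance the left integral is that of \<open>F\<close> over the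
  translate of \<open>Q\<close> by \<open>c\<close>, a subset of the square on which the nonnegative
  \<open>F\<close> is integrated.\<close>

lemma integral_translate_le:
  fixes F :: "real \<times> real \<Rightarrow> real"
  assumes [measurable]: "F \<in> borel_measurable borel" "Q \<in> sets borel"
    and F: "\<And>t. 0 \<le> F t" "\<And>t. t \<in> {0..1} \<times> {0..1} \<Longrightarrow> F t \<le> 1"
    and sub: "\<And>t. t \<in> Q \<Longrightarrow> c + t \<in> {0..1} \<times> {0..1}"
  shows "integrable lborel (\<lambda>t. indicator Q t * F (c + t))"
    "(\<integral>t. indicator Q t * F (c + t) \<partial>lborel) \<le> (\<integral>t. F t \<partial>unit_sq)"
proof -
  let ?S = "{0..1::real} \<times> {0..1::real}"
  interpret S: prob_space unit_sq by (rule prob_space_unit_sq)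
  have "integrable unit_sq F"
    using F S.finite_measure_axioms
    by (intro integrable_bounded_finite_measure[of _ _ 1] borel_measurable_unit_sq) auto
  then have int: "integrable lborel (\<lambda>t. indicator ?S t * F t)"
    unfolding unit_sq_def by (simp add: integrable_restrict_space integrable_completion)
  define f where "f = (\<lambda>u. indicator Q (u - c) * F u)"
  have [measurable]: "f \<in> borel_measurable borel" unfolding f_def by measurable
  have f_le: "f u \<le> indicator ?S u * F u" for u
    using sub[of "u - c"] F(1)[of u] by (auto simp: f_def indicator_def)
  have f_int: "integrable lborel f"
    by (rule Bochner_Integration.integrable_bound[OF int])
       (use f_le F(1) in \<open>auto simp: abs_mult intro!: AE_I2\<close>, auto simp: f_def F(1) intro: f_le)
  have f_shift: "f (c + t) = indicator Q t * F (c + t)" for t by (simp add: f_def)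
  have "integrable (distr lborel borel ((+) c)) f" unfolding lborel_distr_plus by (rule f_int)
  then show "integrable lborel (\<lambda>t. indicator Q t * F (c + t))"
    by (simp add: integrable_distr_eq f_shift)
  have "(\<integral>t. indicator Q t * F (c + t) \<partial>lborel) = (\<integral>u. f u \<partial>distr lborel borel ((+) c))"
    by (simp add: integral_distr f_shift)
  also have "\<dots> = (\<integral>u. f u \<partial>lborel)" unfolding lborel_distr_plus ..
  also have "\<dots> \<le> (\<integral>t. indicator ?S t * F t \<partial>lborel)"
    by (intro integral_mono f_int int f_le)
  finally show "(\<integral>t. indicator Q t * F (c + t) \<partial>lborel) \<le> (\<integral>t. F t \<partial>unit_sq)"
    by (simp add: integral_unit_sq_lborel)
qed

lemma lborel_quarter:
  fixes Q :: "(real \<times> real) set"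
  assumes "Q = {0<..1/2} \<times> {0<..1/2}"
  shows "Q \<in> sets borel" "emeasure lborel Q = ennreal (1/4)"
proof -
  have "Q \<in> sets (borel \<Otimes>\<^sub>M borel)" unfolding assms by measurable
  then show "Q \<in> sets borel" unfolding borel_prod .
  have "emeasure lborel {0<..1/2::real} = ennreal (1/2)"
    by (subst emeasure_lborel_Ioc) auto
  moreover have "ennreal (1/2) * ennreal (1/2) = ennreal (1/4)"
    by (subst ennreal_mult[symmetric]) auto
  ultimately have "emeasure (lborel \<Otimes>\<^sub>M lborel) ({0<..1/2::real} \<times> {0<..1/2::real}) = ennreal (1/4)"
    by (subst lborel.emeasure_pair_measure_Times) simp_all
  then show "emeasure lborel Q = ennreal (1/4)" by (simp add: lborel_prod assms)
qed

text \<open>A second difference of size at least \<open>1 / (3 n)\<close> forces one of its four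
  values to be at least \<open>1 / (12 n)\<close>. Integrating over a square of area 1/4 and
  bounding each of four translates by the full integral gives the factor 1/16.\<close>

lemma integral_anova_disc_ge:
  assumes reg: "proj_regular n x y" and q: "q \<ge> 1"
  shows "(1 / (12 * real n)) powr q / 16 \<le> (\<integral>t. \<bar>anova_disc n x y t\<bar> powr q \<partial>unit_sq)"
proof -
  have n: "n > 0" using reg by (auto simp: proj_regular_def)
  \<comment> \<open>Side 1/2 leaves room for shifts up to 1/2. The left endpoints are excluded so
    that a node at 0 lies strictly below every coordinate, as the case \<open>n = 1\<close>
    requires.\<close>
  define Q :: "(real \<times> real) set" where "Q = {0<..1/2} \<times> {0<..1/2}"
  note Q = lborel_quarter[OF Q_def]
  define r where "r = (1 / (12 * real n)) powr q"
  have r: "r \<ge> 0" by (simp add: r_def)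
  define F where "F = (\<lambda>t. \<bar>anova_disc n x y t\<bar> powr q)"
  have [measurable]: "F \<in> borel_measurable borel" unfolding F_def by measurable
  have F: "0 \<le> F t" "t \<in> {0..1} \<times> {0..1} \<Longrightarrow> F t \<le> 1" for t
    using q by (auto simp: F_def intro!: powr_le1 abs_anova_disc_le_1 n)
  have F_ge: "r \<le> F t" if "1 / (12 * real n) \<le> \<bar>anova_disc n x y t\<bar>" for t
    unfolding r_def F_def using that q by (intro powr_mono2) auto
  have Qr: "integrable lborel (\<lambda>t. indicator Q t * r)" "(\<integral>t. indicator Q t * r \<partial>lborel) = r / 4"
    using Q by (auto simp: measure_def)
  have shift: "integrable lborel (\<lambda>t. indicator Q t * F (c + t))"
    "(\<integral>t. indicator Q t * F (c + t) \<partial>lborel) \<le> (\<integral>t. F t \<partial>unit_sq)"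
    if c: "fst c \<in> {0..1/2}" "snd c \<in> {0..1/2}" for c
  proof -
    have sub: "c + t \<in> {0..1} \<times> {0..1}" if "t \<in> Q" for t
      using c that by (cases c; cases t) (auto simp: Q_def)
    note * = integral_translate_le[OF _ Q(1) F sub]
    show "integrable lborel (\<lambda>t. indicator Q t * F (c + t))" by (rule *(1)) auto
    show "(\<integral>t. indicator Q t * F (c + t) \<partial>lborel) \<le> (\<integral>t. F t \<partial>unit_sq)" by (rule *(2)) auto
  qed
  have "r / 16 \<le> (\<integral>t. F t \<partial>unit_sq)"
  \<comment> \<open>For \<open>n = 1\<close> the box would have width \<open>k = 0\<close>; instead
    the only node is the origin and \<open>anova_disc\<close> is explicitly
    \<open>(1 - fst t) * (1 - snd t)\<close>.\<close>
  proof (cases "n = 1")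
    case True
    then have "x 1 = 0" "y 1 = 0" using reg by (auto simp: proj_regular_def)
    then have "1 / (12 * real n) \<le> \<bar>anova_disc n x y (0 + t)\<bar>" if "t \<in> Q" for t
    proof -
      have "1/2 * (1/2) \<le> (1 - fst t) * (1 - snd t)"
        using that by (intro mult_mono) (auto simp: Q_def)
      then show ?thesis
        using that True \<open>x 1 = 0\<close> \<open>y 1 = 0\<close> by (auto simp: anova_disc_def K_def Q_def algebra_simps)
    qed
    then have "r / 4 \<le> (\<integral>t. indicator Q t * F (0 + t) \<partial>lborel)"
      unfolding Qr(2)[symmetric]
      by (intro integral_mono Qr(1) shift(1)) (auto simp: indicator_def intro!: F_ge)
    with shift(2)[of 0] r show ?thesis by auto
  next
    case False
    then have n2: "n \<ge> 2" using n by simp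
    define k where "k = n div 2"
    define a where "a = real k / real n"
    define b where "b = 1 / real n"
    have ab: "0 \<le> a" "a \<le> 1/2" "0 \<le> b" "b \<le> 1/2"
      using n2 by (auto simp: a_def b_def k_def field_simps)
    have "r \<le> F ((a, b) + t) + F ((a, 0) + t) + F ((0, b) + t) + F (0 + t)" if "t \<in> Q" for t
    proof -
      have "1 / (3 * real n) \<le> \<bar>anova_disc n x y ((a, b) + t) - anova_disc n x y ((a, 0) + t)
          - anova_disc n x y ((0, b) + t) + anova_disc n x y (0 + t)\<bar>"
        using anova_disc_second_difference[OF reg n2 k_def, of "fst t" "snd t"] that
        by (cases t) (auto simp: Q_def a_def b_def add.commute)
      moreover have "1 / (3 * real n) = 4 * (1 / (12 * real n))" by simp
      ultimately have "1 / (12 * real n) \<le> \<bar>anova_disc n x y ((a, b) + t)\<bar>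
          \<or> 1 / (12 * real n) \<le> \<bar>anova_disc n x y ((a, 0) + t)\<bar>
          \<or> 1 / (12 * real n) \<le> \<bar>anova_disc n x y ((0, b) + t)\<bar>
          \<or> 1 / (12 * real n) \<le> \<bar>anova_disc n x y (0 + t)\<bar>" by linarith
      then have "r \<le> F ((a, b) + t) \<or> r \<le> F ((a, 0) + t) \<or> r \<le> F ((0, b) + t) \<or> r \<le> F (0 + t)"
        by (blast intro: F_ge)
      then show ?thesis
        using F(1)[of "(a, b) + t"] F(1)[of "(a, 0) + t"] F(1)[of "(0, b) + t"] F(1)[of "0 + t"]
        by linarith
    qed
    then have "r / 4 \<le> (\<integral>t. indicator Q t * F ((a, b) + t) + indicator Q t * F ((a, 0) + t)
        + indicator Q t * F ((0, b) + t) + indicator Q t * F (0 + t) \<partial>lborel)"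
      unfolding Qr(2)[symmetric] using ab
      by (intro integral_mono Qr(1) Bochner_Integration.integrable_add shift(1))
         (auto simp: indicator_def simp del: add_Pair)
    \<comment> \<open>The translates may overlap, as each is compared with the whole square
      separately.\<close>
    also have "\<dots> \<le> 4 * (\<integral>t. F t \<partial>unit_sq)"
      using ab shift[of "(a, b)"] shift[of "(a, 0)"] shift[of "(0, b)"] shift[of 0] by simp
    finally show ?thesis by simp
  qed
  then show ?thesis by (simp add: r_def F_def)
qed

subsection \<open>Worst case error\<close>

lemma memLp_integrable:
  assumes M: "prob_space M" and p: "1 < p" and h: "memLp p M h"
  shows "integrable M h"
proof -
  interpret prob_space M by (rule M)
  have [measurable]: "h \<in> borel_measurable M" using h by (simp add: memLp_def)
  show ?thesis
  proof (cases "p = \<infinity>")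
    case True
    then have fin: "esssup M (\<lambda>z. ereal \<bar>h z\<bar>) < \<infinity>" using h by (simp add: memLp_def)
    have "AE z in M. \<bar>h z\<bar> \<le> real_of_ereal (esssup M (\<lambda>z. ereal \<bar>h z\<bar>))"
      using esssup_AE[of "\<lambda>z. ereal \<bar>h z\<bar>" M]
      by eventually_elim (use fin in \<open>cases "esssup M (\<lambda>z. ereal \<bar>h z\<bar>)"; auto\<close>)
    then show ?thesis by (intro integrable_const_bound[of h]) auto
  next
    case False
    define r where "r = real_of_ereal p"
    have r: "r > 1" using p False by (cases p) (auto simp: r_def)
    have "integrable M (\<lambda>z. \<bar>h z\<bar> powr r)" using h False by (simp add: memLp_def r_def)
    then have int: "integrable M (\<lambda>z. 1 + \<bar>h z\<bar> powr r)" by simp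
    have bound: "\<bar>h z\<bar> \<le> 1 + \<bar>h z\<bar> powr r" for z
    proof (cases "\<bar>h z\<bar> \<le> 1")
      case False
      then have "\<bar>h z\<bar> powr 1 \<le> \<bar>h z\<bar> powr r" using r by (intro powr_mono) auto
      with False show ?thesis by simp
    qed (auto intro: order_trans)
    show ?thesis
      by (rule Bochner_Integration.integrable_bound[OF int])
         (auto intro!: AE_I2 order_trans[OF bound])
  qed
qed

lemma abs_integral_mult_le_esssup:
  fixes h g :: "'a \<Rightarrow> real"
  assumes M: "prob_space M" and h: "memLp \<infinity> M h" "Lp_norm \<infinity> M h \<le> w"
    and g: "g \<in> borel_measurable M" "\<And>t. t \<in> space M \<Longrightarrow> \<bar>g t\<bar> \<le> 1"
  shows "\<bar>\<integral>t. h t * g t \<partial>M\<bar> \<le> w * (\<integral>t. \<bar>g t\<bar> \<partial>M)"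
proof -
  interpret prob_space M by (rule M)
  have fin: "esssup M (\<lambda>z. ereal \<bar>h z\<bar>) < \<infinity>" using h by (simp add: memLp_def)
  have "AE z in M. \<bar>h z\<bar> \<le> real_of_ereal (esssup M (\<lambda>z. ereal \<bar>h z\<bar>))"
    using esssup_AE[of "\<lambda>z. ereal \<bar>h z\<bar>" M]
    by eventually_elim (use fin in \<open>cases "esssup M (\<lambda>z. ereal \<bar>h z\<bar>)"; auto\<close>)
  then have h_le: "AE z in M. \<bar>h z\<bar> \<le> w"
    by eventually_elim (use h(2) in \<open>simp add: Lp_norm_def\<close>)
  have int: "integrable M h" by (rule memLp_integrable[OF M _ h(1)]) simp
  have gi: "integrable M g"
    using g by (intro integrable_bounded_finite_measure[of _ _ 1]) (auto intro: finite_measure_axioms)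
  have "\<bar>\<integral>t. h t * g t \<partial>M\<bar> \<le> (\<integral>t. \<bar>h t * g t\<bar> \<partial>M)" by (rule integral_abs_bound)
  also have "\<dots> \<le> (\<integral>t. w * \<bar>g t\<bar> \<partial>M)"
  proof (intro integral_mono_AE integrable_abs integrable_mult_bounded[OF int] integrable_mult_right integrable_abs gi g)
    show "AE t in M. \<bar>h t * g t\<bar> \<le> w * \<bar>g t\<bar>"
      using h_le by eventually_elim (simp add: abs_mult mult_right_mono)
  qed
  finally show ?thesis by simp
qed

text \<open>Young's inequality is applied to \<open>\<bar>h t\<bar> / w\<close> and
  \<open>w * \<bar>g t\<bar> / B\<close>. The parameter \<open>B\<close> stays free, so that the
  bounds for several components can be added before it is chosen; this gives the Hoelder inequality
  for the weighted sum and the integrals at once.\<close>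

lemma abs_integral_mult_le_Young:
  fixes h g :: "'a \<Rightarrow> real"
  assumes M: "prob_space M" and h: "memLp (ereal r) M h"
    and rq: "r > 1" "q > 1" "1 / r + 1 / q = 1"
    and g: "g \<in> borel_measurable M" "\<And>t. t \<in> space M \<Longrightarrow> \<bar>g t\<bar> \<le> 1"
    and w: "w > 0" and B: "B > 0"
  shows "\<bar>\<integral>t. h t * g t \<partial>M\<bar> \<le> B * (w powr (- r) * (\<integral>t. \<bar>h t\<bar> powr r \<partial>M) / r
    + w powr q * (\<integral>t. \<bar>g t\<bar> powr q \<partial>M) / B powr q / q)"
proof -
  interpret prob_space M by (rule M)
  have hr: "integrable M (\<lambda>t. \<bar>h t\<bar> powr r)" using h by (simp add: memLp_def)
  have gq: "integrable M (\<lambda>t. \<bar>g t\<bar> powr q)"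
    using g rq by (intro integrable_bounded_finite_measure[of _ _ 1]) (auto intro!: powr_le1 finite_measure_axioms)
  have int: "integrable M h" using memLp_integrable[OF M _ h] rq by simp
  have "\<bar>\<integral>t. h t * g t \<partial>M\<bar> \<le> (\<integral>t. \<bar>h t * g t\<bar> \<partial>M)" by (rule integral_abs_bound)
  also have "\<dots> \<le> (\<integral>t. B * (w powr (- r) * \<bar>h t\<bar> powr r / r + w powr q * \<bar>g t\<bar> powr q / B powr q / q) \<partial>M)"
  proof (intro integral_mono)
    fix t
    have "\<bar>h t\<bar> / w * (w * \<bar>g t\<bar> / B) \<le> (\<bar>h t\<bar> / w) powr r / r + (w * \<bar>g t\<bar> / B) powr q / q"
      using rq w B by (intro Youngs_inequality) auto
    then have "B * (\<bar>h t\<bar> / w * (w * \<bar>g t\<bar> / B))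
        \<le> B * ((\<bar>h t\<bar> / w) powr r / r + (w * \<bar>g t\<bar> / B) powr q / q)"
      using B by (intro mult_left_mono) auto
    moreover have "B * (\<bar>h t\<bar> / w * (w * \<bar>g t\<bar> / B)) = \<bar>h t * g t\<bar>"
      using w B by (simp add: abs_mult)
    ultimately show "\<bar>h t * g t\<bar>
        \<le> B * (w powr (- r) * \<bar>h t\<bar> powr r / r + w powr q * \<bar>g t\<bar> powr q / B powr q / q)"
      using w B by (simp add: powr_divide powr_mult powr_minus_divide)
  qed (use hr gq in \<open>auto intro!: integrable_mult_bounded int g\<close>)
  also have "\<dots> = B * (w powr (- r) * (\<integral>t. \<bar>h t\<bar> powr r \<partial>M) / r
    + w powr q * (\<integral>t. \<bar>g t\<bar> powr q \<partial>M) / B powr q / q)"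
    using hr gq by simp
  finally show ?thesis .
qed

section \<open>The norm of the ANOVA space\<close>

lemma U_plus_eq: "U_plus \<gamma> = {u \<in> {{}, {1}, {2}, {1,2}}. 0 < \<gamma> u}"
proof -
  have "u \<subseteq> {1, 2} \<longleftrightarrow> u \<in> {{}, {1}, {2}, {1, 2}}" for u :: "nat set"
    by auto
  then show ?thesis unfolding U_plus_def by blast
qed

lemma sum_U_plus:
  fixes f :: "nat set \<Rightarrow> real"
  shows "(\<Sum>u\<in>U_plus \<gamma>. f u) = (if 0 < \<gamma> {} then f {} else 0) + (if 0 < \<gamma> {1} then f {1} else 0)
     + (if 0 < \<gamma> {2} then f {2} else 0) + (if 0 < \<gamma> {1,2} then f {1,2} else 0)"
proof -
  have "{1::nat} \<noteq> {2}" "{1::nat} \<noteq> {1,2}" "{2::nat} \<noteq> {1,2}" by auto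
  then show ?thesis
    unfolding U_plus_eq by (subst sum.inter_filter) auto
qed

lemma F2_norm_ereal:
  assumes r: "r > 1"
  shows "F2_norm (ereal r) \<gamma> c h1 h2 h12 =
    ((if 0 < \<gamma> {} then \<gamma> {} powr (- r) * \<bar>c\<bar> powr r else 0)
    + (if 0 < \<gamma> {1} then \<gamma> {1} powr (- r) * (\<integral>t. \<bar>h1 t\<bar> powr r \<partial>unit_int) else 0)
    + (if 0 < \<gamma> {2} then \<gamma> {2} powr (- r) * (\<integral>t. \<bar>h2 t\<bar> powr r \<partial>unit_int) else 0)
    + (if 0 < \<gamma> {1,2} then \<gamma> {1,2} powr (- r) * (\<integral>t. \<bar>h12 t\<bar> powr r \<partial>unit_sq) else 0)) powr (1 / r)"
proof -
  have ne: "{1::nat} \<noteq> {2}" "{1::nat} \<noteq> {1,2}" "{2::nat} \<noteq> {1,2}" by auto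
  have "Lp_norm (ereal r) M h powr r = (\<integral>t. \<bar>h t\<bar> powr r \<partial>M)" for M :: "'a measure" and h
    using r by (simp add: Lp_norm_def powr_powr)
  moreover have "Lp_norm (ereal r) M h powr r = (\<integral>t. \<bar>h t\<bar> powr r \<partial>M)" for M :: "'b measure" and h
    using r by (simp add: Lp_norm_def powr_powr)
  ultimately show ?thesis
    using ne r unfolding F2_norm_def Let_def sum_U_plus by (simp add: Lp_norm_def powr_powr)
qed

lemma F2_norm_infinity_le_iff:
  "F2_norm \<infinity> \<gamma> c h1 h2 h12 \<le> 1 \<longleftrightarrow> (0 < \<gamma> {} \<longrightarrow> \<bar>c\<bar> \<le> \<gamma> {})
    \<and> (0 < \<gamma> {1} \<longrightarrow> Lp_norm \<infinity> unit_int h1 \<le> \<gamma> {1})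
    \<and> (0 < \<gamma> {2} \<longrightarrow> Lp_norm \<infinity> unit_int h2 \<le> \<gamma> {2})
    \<and> (0 < \<gamma> {1,2} \<longrightarrow> Lp_norm \<infinity> unit_sq h12 \<le> \<gamma> {1,2})"
proof -
  have ne: "{1::nat} \<noteq> {2}" "{1::nat} \<noteq> {1,2}" "{2::nat} \<noteq> {1,2}" by auto
  have "finite (U_plus \<gamma>)" by (simp add: U_plus_eq)
  then have Max_le: "Max (insert 0 (N ` U_plus \<gamma>)) \<le> 1 \<longleftrightarrow> (\<forall>u\<in>U_plus \<gamma>. N u \<le> 1)" for N :: "_ \<Rightarrow> real"
    by simp
  have Ball: "(\<forall>u\<in>U_plus \<gamma>. N u \<le> 1) \<longleftrightarrow> (0 < \<gamma> {} \<longrightarrow> N {} \<le> 1) \<and> (0 < \<gamma> {1} \<longrightarrow> N {1} \<le> 1)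
      \<and> (0 < \<gamma> {2} \<longrightarrow> N {2} \<le> 1) \<and> (0 < \<gamma> {1,2} \<longrightarrow> N {1,2} \<le> 1)" for N :: "_ \<Rightarrow> real"
    unfolding U_plus_eq by blast
  show ?thesis
    using ne unfolding F2_norm_def Let_def if_P[OF refl] Max_le Ball
    by (simp add: divide_le_eq_1_pos)
qed

section \<open>Upper bound for the worst case error\<close>

lemma conj_exp_facts:
  assumes "1 < p"
  shows "conj_exp p \<ge> 1"
    and "p = ereal r \<Longrightarrow> r > 1 \<and> conj_exp p > 1 \<and> 1 / r + 1 / conj_exp p = 1"
proof -
  show *: "p = ereal r \<Longrightarrow> r > 1 \<and> conj_exp p > 1 \<and> 1 / r + 1 / conj_exp p = 1" for r
    using assms by (auto simp: conj_exp_def field_simps)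
  then show "conj_exp p \<ge> 1" using assms by (cases p) (auto simp: conj_exp_def)
qed

lemma wce_le:
  assumes p: "1 < p" and n: "n > 0" and \<gamma>: "\<And>u. u \<subseteq> {1,2} \<Longrightarrow> 0 \<le> \<gamma> u" and q: "q = conj_exp p"
  shows "wce p \<gamma> n x y \<le> ereal ((\<gamma> {1} powr q * (\<integral>t. \<bar>disc1 n x t\<bar> powr q \<partial>unit_int)
    + \<gamma> {2} powr q * (\<integral>t. \<bar>disc1 n y t\<bar> powr q \<partial>unit_int)
    + \<gamma> {1,2} powr q * (\<integral>t. \<bar>anova_disc n x y t\<bar> powr q \<partial>unit_sq)) powr (1 / q))"
    (is "_ \<le> ereal (?S powr _)")
  unfolding wce_def
proof (rule SUP_least)
  fix f assume "f \<in> F2_ball p \<gamma>"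
  then obtain c h1 h2 h12 where f: "f = F2_fun \<gamma> c h1 h2 h12"
    and mem: "memLp p unit_int h1" "memLp p unit_int h2" "memLp p unit_sq h12"
    and norm: "F2_norm p \<gamma> c h1 h2 h12 \<le> 1"
    by (auto simp: F2_ball_def)
  have g: "disc1 n v \<in> borel_measurable unit_int" "\<And>t. t \<in> space unit_int \<Longrightarrow> \<bar>disc1 n v t\<bar> \<le> 1"
    "anova_disc n x y \<in> borel_measurable unit_sq" "\<And>t. t \<in> space unit_sq \<Longrightarrow> \<bar>anova_disc n x y t\<bar> \<le> 1" for v
    using n by (auto intro!: borel_measurable_unit_int borel_measurable_unit_sq abs_disc1_le_1 abs_anova_disc_le_1)
  define T1 where "T1 = (if 0 < \<gamma> {1} then \<bar>\<integral>t. h1 t * disc1 n x t \<partial>unit_int\<bar> else 0)"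
  define T2 where "T2 = (if 0 < \<gamma> {2} then \<bar>\<integral>t. h2 t * disc1 n y t \<partial>unit_int\<bar> else 0)"
  define T3 where "T3 = (if 0 < \<gamma> {1,2} then \<bar>\<integral>t. h12 t * anova_disc n x y t \<partial>unit_sq\<bar> else 0)"
  have err: "\<bar>(\<integral>z. f z \<partial>unit_sq) - QMC n x y f\<bar> \<le> T1 + T2 + T3"
    unfolding f T1_def T2_def T3_def
    by (subst QMC_error_F2_fun[OF n]) (auto intro!: memLp_integrable[OF _ p] prob_space_unit_int prob_space_unit_sq mem)
  have q1: "q \<ge> 1" using conj_exp_facts(1)[OF p] q by simp
  have S: "?S \<ge> 0" by (intro add_nonneg_nonneg mult_nonneg_nonneg) auto
  have \<gamma>_0: "\<gamma> {1} \<ge> 0" "\<gamma> {2} \<ge> 0" "\<gamma> {1,2} \<ge> 0" by (auto intro!: \<gamma>)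
  have "T1 + T2 + T3 \<le> ?S powr (1 / q)"
  proof (cases p)
    case PInf
    then have q: "q = 1" using q by (simp add: conj_exp_def)
    note N = norm[unfolded PInf F2_norm_infinity_le_iff]
    have "T1 \<le> \<gamma> {1} * (\<integral>t. \<bar>disc1 n x t\<bar> \<partial>unit_int)"
      "T2 \<le> \<gamma> {2} * (\<integral>t. \<bar>disc1 n y t\<bar> \<partial>unit_int)"
      "T3 \<le> \<gamma> {1,2} * (\<integral>t. \<bar>anova_disc n x y t\<bar> \<partial>unit_sq)"
      unfolding T1_def T2_def T3_def using N mem[unfolded PInf] \<gamma>_0 g
      by (auto intro!: abs_integral_mult_le_esssup prob_space_unit_int prob_space_unit_sq mult_nonneg_nonneg)
    then show ?thesis using \<gamma>_0 by (simp add: q)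
  next
    case (real r)
    have rq: "r > 1" "q > 1" "1 / r + 1 / q = 1" using conj_exp_facts(2)[OF p real] q by auto
    define P1 where "P1 = (if 0 < \<gamma> {1} then \<gamma> {1} powr (- r) * (\<integral>t. \<bar>h1 t\<bar> powr r \<partial>unit_int) else 0)"
    define P2 where "P2 = (if 0 < \<gamma> {2} then \<gamma> {2} powr (- r) * (\<integral>t. \<bar>h2 t\<bar> powr r \<partial>unit_int) else 0)"
    define P3 where "P3 = (if 0 < \<gamma> {1,2} then \<gamma> {1,2} powr (- r) * (\<integral>t. \<bar>h12 t\<bar> powr r \<partial>unit_sq) else 0)"
    define P0 where "P0 = (if 0 < \<gamma> {} then \<gamma> {} powr (- r) * \<bar>c\<bar> powr r else 0)"
    have P0: "P0 \<ge> 0" by (simp add: P0_def)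
    have "(P0 + P1 + P2 + P3) powr (1 / r) \<le> 1"
      using norm unfolding real F2_norm_ereal[OF rq(1)] P0_def P1_def P2_def P3_def .
    then have "P0 + P1 + P2 + P3 \<le> 1"
      using powr_less_mono2[of "1 / r" 1 "P0 + P1 + P2 + P3"] rq(1)
      by (force simp: not_less[symmetric])
    \<comment> \<open>\<open>P0\<close> belongs to the constant component, which the error does not
      see.\<close>
    with P0 have P: "P1 + P2 + P3 \<le> 1" by simp
    show ?thesis
    \<comment> \<open>The bound is proved for every \<open>B\<close> above the claimed value, since
      that value may be 0 while Young's inequality divides by \<open>B\<close>.\<close>
    proof (rule dense_ge)
      fix B assume B: "?S powr (1 / q) < B"
      then have B0: "B > 0" by (rule le_less_trans[rotated]) simp
      have "?S = (?S powr (1 / q)) powr q" using S rq by (simp add: powr_powr)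
      also have "\<dots> \<le> B powr q" using B rq by (intro powr_mono2) auto
      finally have SB: "?S / B powr q \<le> 1" using B0 by (simp add: divide_le_eq)
      have "T1 \<le> B * (P1 / r + \<gamma> {1} powr q * (\<integral>t. \<bar>disc1 n x t\<bar> powr q \<partial>unit_int) / B powr q / q)"
        unfolding T1_def P1_def using abs_integral_mult_le_Young[OF prob_space_unit_int mem(1)[unfolded real] rq g(1,2) _ B0] rq B0
        by auto
      moreover have "T2 \<le> B * (P2 / r + \<gamma> {2} powr q * (\<integral>t. \<bar>disc1 n y t\<bar> powr q \<partial>unit_int) / B powr q / q)"
        unfolding T2_def P2_def using abs_integral_mult_le_Young[OF prob_space_unit_int mem(2)[unfolded real] rq g(1,2) _ B0] rq B0
        by auto
      moreover have "T3 \<le> B * (P3 / r + \<gamma> {1,2} powr q * (\<integral>t. \<bar>anova_disc n x y t\<bar> powr q \<partial>unit_sq) / B powr q / q)"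
        unfolding T3_def P3_def using abs_integral_mult_le_Young[OF prob_space_unit_sq mem(3)[unfolded real] rq g(3,4) _ B0] rq B0
        by auto
      ultimately have "T1 + T2 + T3 \<le> B * ((P1 + P2 + P3) / r + ?S / B powr q / q)"
        by (simp add: add_divide_distrib ring_distribs)
      \<comment> \<open>The first summand uses the unit ball and the second the choice of
        \<open>B\<close>; the conjugate exponents then sum to 1.\<close>
      also have "\<dots> \<le> B * (1 / r + 1 / q)"
        using P SB B0 rq by (intro mult_left_mono add_mono divide_right_mono) auto
      finally show "T1 + T2 + T3 \<le> B" using rq by simp
    qed
  qed (use p in auto)
  with err show "ereal \<bar>(\<integral>z. f z \<partial>unit_sq) - QMC n x y f\<bar> \<le> ereal (?S powr (1 / q))" by simp
qed

section \<open>Lower bound for the worst case error\<close>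

lemma memLp_zero: "prob_space M \<Longrightarrow> memLp p M (\<lambda>_. 0)"
  using prob_space.emeasure_space_1[of M] by (auto simp: memLp_def esssup_const zero_ereal_def[symmetric])

lemma Lp_norm_infinity_zero: "prob_space M \<Longrightarrow> Lp_norm \<infinity> M (\<lambda>_. 0) = 0"
  using prob_space.emeasure_space_1[of M] by (auto simp: Lp_norm_def esssup_const zero_ereal_def[symmetric])

lemma F2_fun_in_ball:
  assumes p: "1 < p" and \<gamma>: "0 \<le> \<gamma> {1,2}"
    and h: "memLp p unit_sq h" "Lp_norm p unit_sq h \<le> \<gamma> {1,2}"
  shows "F2_fun \<gamma> 0 (\<lambda>_. 0) (\<lambda>_. 0) h \<in> F2_ball p \<gamma>"
proof -
  have "F2_norm p \<gamma> 0 (\<lambda>_. 0) (\<lambda>_. 0) h \<le> 1"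
  proof (cases p)
    case PInf
    then show ?thesis
      using h by (simp add: F2_norm_infinity_le_iff Lp_norm_infinity_zero prob_space_unit_int)
  next
    case (real r)
    then have r: "r > 1" using p by simp
    define I where "I = (\<integral>t. \<bar>h t\<bar> powr r \<partial>unit_sq)"
    have "I = (I powr (1 / r)) powr r" using r by (simp add: powr_powr I_def)
    also have "\<dots> \<le> \<gamma> {1,2} powr r"
      using h(2) r by (intro powr_mono2) (auto simp: real Lp_norm_def I_def)
    finally have "0 < \<gamma> {1,2} \<Longrightarrow> \<gamma> {1,2} powr (- r) * I \<le> 1"
      by (simp add: powr_minus_divide divide_le_eq)
    moreover have "0 \<le> \<gamma> {1,2} powr (- r) * I" by (simp add: I_def)
    ultimately show ?thesis
      unfolding real F2_norm_ereal[OF r] using r by (auto simp: I_def[symmetric] intro!: powr_le1)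
  qed (use p in auto)
  then show ?thesis
    unfolding F2_ball_def using h(1) memLp_zero[OF prob_space_unit_int] by blast
qed

text \<open>One test function with only the bivariate component suffices: it is extremal for pairing
  with \<open>anova_disc\<close>. Positivity of \<open>I\<close> permits its normalization.\<close>

lemma wce_ge:
  assumes p: "1 < p" and n: "n > 0" and \<gamma>: "0 \<le> \<gamma> {1,2}" and q: "q = conj_exp p"
    and I: "I = (\<integral>t. \<bar>anova_disc n x y t\<bar> powr q \<partial>unit_sq)" "I > 0"
  shows "ereal (\<gamma> {1,2} * I powr (1 / q)) \<le> wce p \<gamma> n x y"
proof -
  interpret S: prob_space unit_sq by (rule prob_space_unit_sq)
  define w where "w = \<gamma> {1,2}"
  have w: "w \<ge> 0" using \<gamma> by (simp add: w_def)
  define g where "g = anova_disc n x y"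
  have [measurable]: "g \<in> borel_measurable unit_sq"
    unfolding g_def by (intro borel_measurable_unit_sq) simp
  have g_le: "\<bar>g t\<bar> \<le> 1" if "t \<in> space unit_sq" for t
    using that n by (auto simp: g_def intro!: abs_anova_disc_le_1)
  have q1: "q \<ge> 1" using conj_exp_facts(1)[OF p] q by simp
  \<comment> \<open>Scaled so that the Hoelder inequality for the product of \<open>h\<close> and \<open>g\<close> is an equality.\<close>
  define h where "h = (\<lambda>t. w * (sgn (g t) * \<bar>g t\<bar> powr (q - 1)) / I powr (1 - 1 / q))"
  have [measurable]: "h \<in> borel_measurable unit_sq" unfolding h_def by measurable
  have hg: "h t * g t = w / I powr (1 - 1 / q) * \<bar>g t\<bar> powr q" for t
  proof -
    have "sgn (g t) * \<bar>g t\<bar> powr (q - 1) * g t = \<bar>g t\<bar> powr q"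
      by (cases "g t = 0") (auto simp: powr_diff sgn_if)
    then show ?thesis by (simp add: h_def mult.assoc)
  qed
  have h: "memLp p unit_sq h \<and> Lp_norm p unit_sq h \<le> w"
  proof (cases p)
    case PInf
    then have q: "q = 1" using q by (simp add: conj_exp_def)
    \<comment> \<open>For \<open>q = 1\<close> the function \<open>h\<close> is \<open>w\<close>
      times the sign of \<open>g\<close>.\<close>
    have "\<bar>h t\<bar> \<le> w" for t
      using w I(2) by (auto simp: h_def q abs_mult sgn_if)
    then have "esssup unit_sq (\<lambda>t. ereal \<bar>h t\<bar>) \<le> ereal w" by (intro esssup_I) auto
    then show ?thesis using w
      by (cases "esssup unit_sq (\<lambda>t. ereal \<bar>h t\<bar>)") (auto simp: PInf memLp_def Lp_norm_def)
  next
    case (real r)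
    have rq: "r > 1" "q > 1" "1 / r + 1 / q = 1" using conj_exp_facts(2)[OF p real] q by auto
    \<comment> \<open>These exponent identities turn the \<open>r\<close>-th power of
      \<open>h\<close> into the \<open>q\<close>-th power of \<open>g\<close> divided by its
      integral \<open>I\<close>.\<close>
    have e: "(q - 1) * r = q" "(1 - 1 / q) * r = 1" using rq by (auto simp: field_simps)
    have hr: "\<bar>h t\<bar> powr r = w powr r * \<bar>g t\<bar> powr q / I" for t
    proof -
      have "\<bar>h t\<bar> = w * \<bar>g t\<bar> powr (q - 1) / I powr (1 - 1 / q)"
        using w by (cases "g t = 0") (auto simp: h_def abs_mult sgn_if)
      then show ?thesis using w I(2) by (simp add: powr_divide powr_mult powr_powr e)
    qed
    have "integrable unit_sq (\<lambda>t. \<bar>g t\<bar> powr q)"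
      using g_le q1 S.finite_measure_axioms
      by (intro integrable_bounded_finite_measure[of _ _ 1]) (auto intro!: powr_le1)
    moreover have "(\<integral>t. w powr r * \<bar>g t\<bar> powr q / I \<partial>unit_sq) = w powr r"
      using I by (simp add: g_def)
    ultimately show ?thesis using w rq by (simp add: real memLp_def Lp_norm_def hr powr_powr)
  qed (use p in auto)
  define f where "f = F2_fun \<gamma> 0 (\<lambda>_. 0) (\<lambda>_. 0) h"
  have f: "f \<in> F2_ball p \<gamma>" unfolding f_def using h \<gamma> by (intro F2_fun_in_ball p) (auto simp: w_def)
  have "\<bar>(\<integral>z. f z \<partial>unit_sq) - QMC n x y f\<bar> = \<bar>if 0 < \<gamma> {1,2} then \<integral>t. h t * g t \<partial>unit_sq else 0\<bar>"
    unfolding f_def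
    by (subst QMC_error_F2_fun[OF n])
       (use memLp_integrable[OF prob_space_unit_sq p] h in \<open>auto simp: g_def\<close>)
  \<comment> \<open>If the weight is 0, then \<open>h\<close> is 0 and both sides vanish.\<close>
  also have "\<dots> = \<bar>\<integral>t. h t * g t \<partial>unit_sq\<bar>"
    using \<gamma> by (auto simp: h_def w_def)
  also have "(\<integral>t. h t * g t \<partial>unit_sq) = w / I powr (1 - 1 / q) * I"
    unfolding hg I(1) by (simp add: g_def)
  also have "\<dots> = w * I powr (1 / q)"
    using I(2) by (simp add: powr_diff)
  finally have "\<bar>(\<integral>z. f z \<partial>unit_sq) - QMC n x y f\<bar> = \<gamma> {1,2} * I powr (1 / q)"
    using w by (simp add: w_def)
  then show ?thesis
    unfolding wce_def by (intro SUP_upper2[OF f]) simp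
qed

theorem theorem2:
  fixes p :: ereal
  assumes "1 < p"
  shows "(\<forall>(\<gamma>::nat set \<Rightarrow> real) n x y.
            (\<forall>u. u \<subseteq> {1,2} \<longrightarrow> 0 \<le> \<gamma> u) \<and> proj_regular n x y \<longrightarrow>
            wce p \<gamma> n x y \<le> ereal (1 / real n *
              ((\<gamma> {1} powr conj_exp p + \<gamma> {2} powr conj_exp p) / (conj_exp p + 1)
               + 3 powr (conj_exp p - 1) * \<gamma> {1,2} powr conj_exp p *
                 (2 / (conj_exp p + 1)^2
                  + (real n * L_disc (conj_exp p) n x y) powr conj_exp p))
              powr (1 / conj_exp p)))
       \<and> (\<exists>C>0. \<forall>(\<gamma>::nat set \<Rightarrow> real) n x y.
            (\<forall>u. u \<subseteq> {1,2} \<longrightarrow> 0 \<le> \<gamma> u) \<and> proj_regular n x y \<longrightarrow>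
            ereal (C * \<gamma> {1,2} * L_disc (conj_exp p) n x y) \<le> wce p \<gamma> n x y)"
proof -
  define q where "q = conj_exp p"
  have q: "q \<ge> 1" using conj_exp_facts(1)[OF assms] by (simp add: q_def)
  define D where "D = (\<lambda>n x y. \<integral>t. \<bar>discrepancy n x y t\<bar> powr q \<partial>unit_sq)"
  define I where "I = (\<lambda>n x y. \<integral>t. \<bar>anova_disc n x y t\<bar> powr q \<partial>unit_sq)"
  have D0: "D n x y \<ge> 0" for n x y by (simp add: D_def)
  have L: "L_disc q n x y = D n x y powr (1 / q)" for n x y by (simp add: L_disc_def D_def)
  have upper: "wce p \<gamma> n x y \<le> ereal (1 / real n *
              ((\<gamma> {1} powr q + \<gamma> {2} powr q) / (q + 1) + 3 powr (q - 1) * \<gamma> {1,2} powr q *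
                 (2 / (q + 1)^2 + (real n * L_disc q n x y) powr q)) powr (1 / q))"
    if \<gamma>: "\<And>u. u \<subseteq> {1,2} \<Longrightarrow> 0 \<le> \<gamma> u" and reg: "proj_regular n x y" for \<gamma> :: "nat set \<Rightarrow> real" and n x y
  proof -
    have n: "n > 0" and x: "x ` {1..n} = (\<lambda>j. real j / real n) ` {0..<n}"
      and y: "y ` {1..n} = (\<lambda>j. real j / real n) ` {0..<n}"
      using reg by (auto simp: proj_regular_def)
    define N where "N = real n powr q"
    have N: "N > 0" using n by (simp add: N_def)
    have n_powr: "(1 / real n) powr q = 1 / N" using n by (simp add: N_def powr_divide)
    have nL: "(real n * L_disc q n x y) powr q = N * D n x y"
      using q D0 by (simp add: L powr_mult powr_powr N_def)
    define R where "R = (\<gamma> {1} powr q + \<gamma> {2} powr q) / (q + 1) + 3 powr (q - 1) * \<gamma> {1,2} powr q *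
                 (2 / (q + 1)^2 + N * D n x y)"
    have R0: "R \<ge> 0"
      unfolding R_def using q D0 N by (intro add_nonneg_nonneg mult_nonneg_nonneg divide_nonneg_nonneg) auto
    have "\<gamma> {1} powr q * (\<integral>t. \<bar>disc1 n x t\<bar> powr q \<partial>unit_int)
        + \<gamma> {2} powr q * (\<integral>t. \<bar>disc1 n y t\<bar> powr q \<partial>unit_int) + \<gamma> {1,2} powr q * I n x y
      \<le> \<gamma> {1} powr q * (1 / N / (q + 1)) + \<gamma> {2} powr q * (1 / N / (q + 1))
        + \<gamma> {1,2} powr q * (3 powr (q - 1) * (D n x y + 2 * (1 / N) / (q + 1)^2))"
      unfolding integral_disc1_powr[OF n x q] integral_disc1_powr[OF n y q] n_powr
      using anova_disc_discrepancy_comparison(1)[OF reg q]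
      by (intro add_mono mult_left_mono order_refl) (auto simp: I_def D_def n_powr)
    \<comment> \<open>The factor \<open>1 / N\<close> is common to all terms once the discrepancy is
      written as \<open>N * D n x y\<close>; its \<open>q\<close>-th root is the
      \<open>1 / n\<close> in front of the bracket.\<close>
    also have "\<dots> = R / N"
      using N by (simp add: R_def add_divide_distrib ring_distribs) (simp add: ac_simps)
    finally have "wce p \<gamma> n x y \<le> ereal ((R / N) powr (1 / q))"
      using q by (intro order_trans[OF wce_le[OF assms n \<gamma> q_def]])
        (auto intro!: powr_mono2 add_nonneg_nonneg mult_nonneg_nonneg simp: I_def)
    also have "(R / N) powr (1 / q) = 1 / real n * R powr (1 / q)"
      using R0 N n q by (simp add: powr_divide N_def powr_powr)
    finally show ?thesis unfolding R_def nL .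
  qed
  \<comment> \<open>The factor \<open>3 powr (q - 1)\<close> comes from the comparison, and
    \<open>32 * 12 powr q\<close> bounds two correction terms, each at most
    \<open>16 * 12 powr q\<close> times \<open>I\<close>. Only \<open>q\<close> enters, so the
    constant of the theorem depends on \<open>q\<close> alone.\<close>
  define A where "A = 3 powr (q - 1) * (1 + 32 * 12 powr q)"
  have A: "A > 0" by (auto simp: A_def intro!: mult_pos_pos add_pos_pos)
  have lower: "ereal (A powr (- (1 / q)) * \<gamma> {1,2} * L_disc q n x y) \<le> wce p \<gamma> n x y"
    if \<gamma>: "\<And>u. u \<subseteq> {1,2} \<Longrightarrow> 0 \<le> \<gamma> u" and reg: "proj_regular n x y" for \<gamma> :: "nat set \<Rightarrow> real" and n x y
  proof -
    have n: "n > 0" using reg by (auto simp: proj_regular_def)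
    have \<gamma>12: "0 \<le> \<gamma> {1,2}" by (rule \<gamma>) simp
    have I_ge: "(1 / (12 * real n)) powr q / 16 \<le> I n x y"
      unfolding I_def by (rule integral_anova_disc_ge[OF reg q])
    then have I_pos: "I n x y > 0" using n by (intro less_le_trans[OF _ I_ge]) simp
    have "(1 / real n) powr q / 12 powr q / 16 \<le> I n x y"
      using I_ge n by (simp add: powr_divide powr_mult mult.commute)
    then have n_le: "(1 / real n) powr q \<le> 16 * 12 powr q * I n x y"
      by (simp add: field_simps)
    \<comment> \<open>The gain \<open>(q + 1)^2\<close> is given away, as only some constant is
      wanted.\<close>
    have "(q + 1)^2 \<ge> 1" using q by (simp add: one_le_power)
    then have "2 * (1 / real n) powr q / (q + 1)^2 \<le> 2 * (1 / real n) powr q"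
      by (simp add: divide_le_eq mult_le_cancel_left1)
    also have "\<dots> \<le> 32 * 12 powr q * I n x y" using n_le by linarith
    finally have *: "I n x y + 2 * (1 / real n) powr q / (q + 1)^2 \<le> (1 + 32 * 12 powr q) * I n x y"
      unfolding distrib_right by linarith
    have "D n x y \<le> 3 powr (q - 1) * (I n x y + 2 * (1 / real n) powr q / (q + 1)^2)"
      unfolding D_def I_def by (rule anova_disc_discrepancy_comparison(2)[OF reg q])
    also have "\<dots> \<le> 3 powr (q - 1) * ((1 + 32 * 12 powr q) * I n x y)"
      by (intro mult_left_mono *) auto
    also have "\<dots> = A * I n x y" by (simp only: A_def mult.assoc)
    finally have "D n x y \<le> A * I n x y" .
    then have "L_disc q n x y \<le> (A * I n x y) powr (1 / q)"
      unfolding L using q D0 by (intro powr_mono2) auto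
    also have "\<dots> = A powr (1 / q) * I n x y powr (1 / q)" using A I_pos by (simp add: powr_mult)
    finally have "A powr (- (1 / q)) * L_disc q n x y
        \<le> A powr (- (1 / q)) * (A powr (1 / q) * I n x y powr (1 / q))"
      by (intro mult_left_mono) auto
    also have "\<dots> = I n x y powr (1 / q)" using A by (simp add: powr_minus)
    finally have "\<gamma> {1,2} * (A powr (- (1 / q)) * L_disc q n x y) \<le> \<gamma> {1,2} * I n x y powr (1 / q)"
      using \<gamma>12 by (intro mult_left_mono)
    then have "ereal (A powr (- (1 / q)) * \<gamma> {1,2} * L_disc q n x y) \<le> ereal (\<gamma> {1,2} * I n x y powr (1 / q))"
      by (simp add: ac_simps)
    also have "\<dots> \<le> wce p \<gamma> n x y"
      using I_pos unfolding I_def by (rule wce_ge[where \<gamma> = \<gamma>, OF assms n \<gamma>12 q_def refl])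
    finally show ?thesis .
  qed
  show ?thesis
    unfolding q_def[symmetric]
    by (intro conjI exI[of _ "A powr (- (1 / q))"] allI impI upper lower) (use A in simp_all)
qed

end
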